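(* Let either $K=\mathbb Q$ and $\hat K=\mathbb R$, or $K=\mathbb Q(i\sqrt d)$ and $\hat K=\mathbb C$ with $d\in\mathbb N$ square-free, and let $\beta_0\in K_{quad}$. Then $\mathbf{Bad}_{\hat K,\beta_0}$ is absolute winning in $\hat K$. Moreover, there exist $t_0$, $t_1$ and a positive constant $k_0>0$ such that: in the case $\hat K=\mathbb C$, $[t_0,\infty)\subset\mathcal S_{\mathbb C,\beta_0}$ and for all $t\ge t_0$ $$\mathfrak D^0_{\mathbb C,\beta_0}(t)\ \ge\ 1-\frac{k_0}{t};$$ and (in both cases) for all $t\in\mathcal S_{\hat K,\beta_0}$ with $t\ge t_1$ $$\mathfrak D_{\hat K,\beta_0}(t)\ \ge\ \dim(\hat K)-\frac{k_0}{t\cdot e^{\dim(\hat K)t/2}} .$$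
   Context: $\mathcal O_K$ is the ring of integers of $K$. $K_{quad}$ denotes the set of real (if $K=\mathbb Q$), respectively complex (if $K=\mathbb Q(i\sqrt d)$), quadratic irrational numbers over $K$ in $\hat K$; for $\beta\in K_{quad}$, $\beta^\sigma$ is its Galois conjugate over $K$. $PSL(2,\mathcal O_K)$ acts on $\hat K\cup\{\infty\}$ by Möbius transformations, preserving $K_{quad}$ and commuting with $\sigma$ on it. $\mathcal P_{\beta_0}=PSL(2,\mathcal O_K)\cdot\{\beta_0,\beta_0^\sigma\}$. For $x\in\hat K$ set $$c_{\beta_0}(x)=\inf_{(\beta,\beta^\sigma),\ \beta\in\mathcal P_{\beta_0}}|\beta-\beta^\sigma|^{-1}|x-\beta|,$$ $\mathbf{Bad}_{\hat K,\beta_0}=\{x\in\hat K:c_{\beta_0}(x)>0\}$, $\mathcal S_{\hat K,\beta_0}=\{-\log c_{\beta_0}(x):x\in\mathbf{Bad}_{\hat K,\beta_0}\}$, and for $t\in\mathcal S_{\hat K,\beta_0}$ let $\mathfrak D_{\hat K,\beta_0}(t)=\dim\{x\in\mathbf{Bad}_{\hat K,\beta_0}:-\log c_{\beta_0}(x)\le t\}$ and $\mathfrak D^0_{\hat K,\beta_0}(t)=\dim\{x\in\mathbf{Bad}_{\hat K,\beta_0}:-\log c_{\beta_0}(x)=t\}$ (Hausdorff dimension). $\dim(\mathbb R)=1$, $\dim(\mathbb C)=2$. Absolute game. Let $\bar X$ be a proper metric space, $X\subset\bar X$ closed; fix $\beta_*>0$ and $0<\beta<\beta_*$. Bob starts with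 a metric ball $B_0=B(x_0,r_0)$, $x_0\in X$. At step $k\ge0$, given Bob's ball $B_k=B(x_k,r_k)$ with $x_k\in X$, Alice blocks a ball $A_k=B(y_k,\alpha_kr_k)$ with $y_k\in\bar X$ and $0<\alpha_k<\beta$; then Bob chooses $B_{k+1}=B(x_{k+1},r_{k+1})\subset B_k\setminus A_k$ with $x_{k+1}\in X$, $\beta r_k\le r_{k+1}\le r_k$. A set $Y\subset X$ is $\beta$-absolute winning in $X$ if Alice has a strategy guaranteeing that $\bigcap_{k\ge0}B_k$ meets $Y$, no matter how Bob plays; $Y$ is absolute winning in $X$ (given $\beta_*$) if it is $\beta$-absolute winning for all $0<\beta<\beta_*$. "Absolute winning" without mention of $\beta_*$ is understood for some fixed $\beta_*>0$ depending only on the pair $X\subset\bar X$. Here $X=\bar X=\hat K$ with the Euclidean metric. *)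

theory Defs
  imports "HOL-Analysis.Analysis" "HOL-Computational_Algebra.Polynomial" "HOL-Computational_Algebra.Squarefree"
begin

section \<open>Quadratic irrationals and approximation by an orbit of them\<close>

text \<open>
  The field \<open>K\<close> is a subset of its completion \<open>'a\<close>: either \<open>\<rat>\<close> inside \<^typ>\<open>real\<close>, or the following
  imaginary quadratic field inside \<^typ>\<open>complex\<close>.
\<close>

definition imag_quad_field :: "nat \<Rightarrow> complex set" where
  "imag_quad_field d = {x + y * (\<i> * of_real (sqrt (real d))) | x y. x \<in> \<rat> \<and> y \<in> \<rat>}"

definition ring_of_integers :: "'a::field_char_0 set \<Rightarrow> 'a set" where
  "ring_of_integers K = {x \<in> K. algebraic_int x}"

lemma ring_of_integers_Rats: "ring_of_integers (\<rat> :: real set) = \<int>"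
  using Ints_subset_Rats
  by (auto simp: ring_of_integers_def intro: rational_algebraic_int_is_int int_imp_algebraic_int)

definition quad_irrationals :: "'a::field set \<Rightarrow> 'a set" where
  "quad_irrationals K =
     {\<beta>. \<beta> \<notin> K \<and> (\<exists>a\<in>K. \<exists>b\<in>K. \<exists>c\<in>K. a \<noteq> 0 \<and> a * \<beta>\<^sup>2 + b * \<beta> + c = 0)}"

text \<open>
  The Galois conjugate is the other root of the minimal polynomial over \<open>K\<close>.  For a quadratic
  irrational it exists and is unique in characteristic 0 (see the lemma below); elsewhere the
  value is irrelevant.
\<close>

definition galois_conj :: "'a::field set \<Rightarrow> 'a \<Rightarrow> 'a" where
  "galois_conj K \<beta> =
     (THE \<gamma>. \<gamma> \<noteq> \<beta> \<and> (\<exists>b\<in>K. \<exists>c\<in>K. poly [:c, b, 1:] \<beta> = 0 \<and> poly [:c, b, 1:] \<gamma> = 0))"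

lemma galois_conj_eq:
  fixes K :: "'a::field_char_0 set"
  assumes K: "1 \<in> K" "\<And>x y. x \<in> K \<Longrightarrow> y \<in> K \<Longrightarrow> x - y \<in> K"
      "\<And>x y. x \<in> K \<Longrightarrow> y \<in> K \<Longrightarrow> x / y \<in> K"
    and \<beta>: "\<beta> \<notin> K" and bc: "b \<in> K" "c \<in> K" "\<beta>\<^sup>2 + b * \<beta> + c = 0"
  shows "galois_conj K \<beta> = - b - \<beta>"
  unfolding galois_conj_def
proof (rule the_equality)
  have 0: "0 \<in> K" using K(2)[OF K(1) K(1)] by simp
  have "1 - (0 - 1) \<in> K" by (intro K 0)
  then have 2: "(2::'a) \<in> K" by simp
  have "- b - \<beta> \<noteq> \<beta>"
  proof
    assume "- b - \<beta> = \<beta>"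
    then have "\<beta> = (0 - b) / 2" by (simp add: field_simps)
    moreover have "(0 - b) / 2 \<in> K" by (intro K 0 2 bc)
    ultimately show False using \<beta> by simp
  qed
  moreover have "poly [:c, b, 1:] \<beta> = 0"
    using bc(3) by (simp add: algebra_simps power2_eq_square)
  moreover have "poly [:c, b, 1:] (- b - \<beta>) = 0"
    using bc(3) by (simp add: algebra_simps power2_eq_square)
  ultimately show "- b - \<beta> \<noteq> \<beta> \<and> (\<exists>b'\<in>K. \<exists>c'\<in>K. poly [:c', b', 1:] \<beta> = 0 \<and>
      poly [:c', b', 1:] (- b - \<beta>) = 0)"
    using bc(1,2) by blast
next
  fix \<gamma>
  assume "\<gamma> \<noteq> \<beta> \<and> (\<exists>b\<in>K. \<exists>c\<in>K. poly [:c, b, 1:] \<beta> = 0 \<and> poly [:c, b, 1:] \<gamma> = 0)"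
  then obtain b' c' where *: "\<gamma> \<noteq> \<beta>" "b' \<in> K" "c' \<in> K" "\<beta> * \<beta> + b' * \<beta> + c' = 0"
      "\<gamma> * \<gamma> + b' * \<gamma> + c' = 0"
    by (auto simp: algebra_simps)
  have eq: "(b - b') * \<beta> = c' - c"
    using bc(3) *(4) by (simp add: algebra_simps power2_eq_square eq_neg_iff_add_eq_0)
       (metis add.assoc add_left_cancel add.commute)
  have "b = b'"
  proof (rule ccontr)
    assume "b \<noteq> b'"
    then have "\<beta> = (c' - c) / (b - b')" using eq by (simp add: field_simps)
    then show False using \<beta> bc * K by metis
  qed
  moreover have "(\<gamma> - \<beta>) * (\<gamma> + \<beta> + b') = (\<gamma> * \<gamma> + b' * \<gamma> + c') - (\<beta> * \<beta> + b' * \<beta> + c')"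
    by (simp add: algebra_simps)
  then have "(\<gamma> - \<beta>) * (\<gamma> + \<beta> + b') = 0" using * by simp
  then have "\<gamma> + \<beta> + b' = 0" using *(1) by simp
  ultimately show "\<gamma> = - b - \<beta>" by (simp add: algebra_simps eq_neg_iff_add_eq_0)
qed

text \<open>
  The orbit of \<open>\<beta>\<^sub>0\<close> and its conjugate under \<open>PSL(2, O\<^sub>K)\<close>.  The matrices range over \<open>SL(2, O\<^sub>K)\<close>, which
  has the same orbits.  No point at infinity is needed: \<open>c * z + d \<noteq> 0\<close> for \<open>z \<notin> K\<close> and
  \<open>a * d - b * c = 1\<close>.
\<close>

definition psl_orbit :: "'a::field_char_0 set \<Rightarrow> 'a \<Rightarrow> 'a set" where
  "psl_orbit K \<beta>0 =
     {(a * z + b) / (c * z + d) | a b c d z.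
        a \<in> ring_of_integers K \<and> b \<in> ring_of_integers K \<and>
        c \<in> ring_of_integers K \<and> d \<in> ring_of_integers K \<and>
        a * d - b * c = 1 \<and> z \<in> {\<beta>0, galois_conj K \<beta>0}}"

definition approx_const :: "'a::real_normed_field set \<Rightarrow> 'a \<Rightarrow> 'a \<Rightarrow> real" where
  "approx_const K \<beta>0 x =
     (INF \<beta>\<in>psl_orbit K \<beta>0. inverse (norm (\<beta> - galois_conj K \<beta>)) * norm (x - \<beta>))"

definition Bad :: "'a::real_normed_field set \<Rightarrow> 'a \<Rightarrow> 'a set" where
  "Bad K \<beta>0 = {x. approx_const K \<beta>0 x > 0}"

definition spectrum_set :: "'a::real_normed_field set \<Rightarrow> 'a \<Rightarrow> real set" where
  "spectrum_set K \<beta>0 = {- ln (approx_const K \<beta>0 x) | x. x \<in> Bad K \<beta>0}"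


section \<open>Hausdorff dimension\<close>

text \<open>
  Only exponents \<open>s > 0\<close> are used, so \<open>0 powr s = 0\<close> is the right weight for points and for the
  empty set.  The boundedness condition is needed because \<^const>\<open>diameter\<close> is unspecified on
  unbounded sets.
\<close>

definition hausdorff_premeasure :: "real \<Rightarrow> real \<Rightarrow> 'a::metric_space set \<Rightarrow> ennreal" where
  "hausdorff_premeasure \<delta> s E =
     (INF U \<in> {U :: nat \<Rightarrow> 'a set. (\<forall>i. bounded (U i) \<and> diameter (U i) \<le> \<delta>) \<and> E \<subseteq> (\<Union>i. U i)}.
        \<Sum>i. ennreal (diameter (U i) powr s))"

definition hausdorff_measure :: "real \<Rightarrow> 'a::metric_space set \<Rightarrow> ennreal" where
  "hausdorff_measure s E = (SUP \<delta>\<in>{0<..}. hausdorff_premeasure \<delta> s E)"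

definition hausdorff_dim :: "'a::metric_space set \<Rightarrow> ereal" where
  "hausdorff_dim E = Inf {ereal s | s. s > 0 \<and> hausdorff_measure s E = 0}"

definition bad_dim_le :: "'a::real_normed_field set \<Rightarrow> 'a \<Rightarrow> real \<Rightarrow> ereal" where
  "bad_dim_le K \<beta>0 t = hausdorff_dim {x \<in> Bad K \<beta>0. - ln (approx_const K \<beta>0 x) \<le> t}"

definition bad_dim_eq :: "'a::real_normed_field set \<Rightarrow> 'a \<Rightarrow> real \<Rightarrow> ereal" where
  "bad_dim_eq K \<beta>0 t = hausdorff_dim {x \<in> Bad K \<beta>0. - ln (approx_const K \<beta>0 x) = t}"


section \<open>The absolute game\<close>

text \<open>
  The ambient proper metric space is the whole type \<open>'a\<close>; the game is played on a closed subset \<open>X\<close>.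
  Balls are closed and are given by a centre and a radius.  A strategy for Alice maps the list
  \<open>[B\<^sub>0, \<dots>, B\<^sub>k]\<close> of Bob's balls so far to the pair \<open>(y\<^sub>k, \<alpha>\<^sub>k)\<close> of the centre and the \<^emph>\<open>relative\<close>
  radius of the ball \<open>A\<^sub>k = B(y\<^sub>k, \<alpha>\<^sub>k r\<^sub>k)\<close> that she blocks; her own earlier moves are determined by
  this list.
\<close>

type_synonym 'a alice_strategy = "('a \<times> real) list \<Rightarrow> 'a \<times> real"

definition legal_strategy :: "real \<Rightarrow> 'a alice_strategy \<Rightarrow> bool" where
  "legal_strategy \<beta> \<sigma> \<longleftrightarrow> (\<forall>h. 0 < snd (\<sigma> h) \<and> snd (\<sigma> h) < \<beta>)"

definition blocked_ball ::
  "'a::metric_space alice_strategy \<Rightarrow> (nat \<Rightarrow> 'a) \<Rightarrow> (nat \<Rightarrow> real) \<Rightarrow> nat \<Rightarrow> 'a set" where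
  "blocked_ball \<sigma> x r k =
     (case \<sigma> (map (\<lambda>j. (x j, r j)) [0..<Suc k]) of (y, \<alpha>) \<Rightarrow> cball y (\<alpha> * r k))"

definition bob_play ::
  "real \<Rightarrow> 'a::metric_space set \<Rightarrow> 'a alice_strategy \<Rightarrow> (nat \<Rightarrow> 'a) \<Rightarrow> (nat \<Rightarrow> real) \<Rightarrow> bool" where
  "bob_play \<beta> X \<sigma> x r \<longleftrightarrow>
     r 0 > 0 \<and> (\<forall>k. x k \<in> X) \<and>
     (\<forall>k. cball (x (Suc k)) (r (Suc k)) \<subseteq> cball (x k) (r k) - blocked_ball \<sigma> x r k \<and>
          \<beta> * r k \<le> r (Suc k) \<and> r (Suc k) \<le> r k)"

definition beta_absolute_winning ::
  "real \<Rightarrow> 'a::heine_borel set \<Rightarrow> 'a set \<Rightarrow> bool" where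
  "beta_absolute_winning \<beta> X Y \<longleftrightarrow>
     Y \<subseteq> X \<and>
     (\<exists>\<sigma>. legal_strategy \<beta> \<sigma> \<and>
        (\<forall>x r. bob_play \<beta> X \<sigma> x r \<longrightarrow> (\<Inter>k. cball (x k) (r k)) \<inter> Y \<noteq> {}))"

text \<open>Here \<open>\<beta>s\<close> is the threshold \<open>\<beta>\<^sub>*\<close>.\<close>

definition absolute_winning :: "real \<Rightarrow> 'a::heine_borel set \<Rightarrow> 'a set \<Rightarrow> bool" where
  "absolute_winning \<beta>s X Y \<longleftrightarrow> (\<forall>\<beta>. 0 < \<beta> \<and> \<beta> < \<beta>s \<longrightarrow> beta_absolute_winning \<beta> X Y)"

end

theory Submission
  imports Defs "HOL-Computational_Algebra.Polynomial_Factorial"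
begin

text \<open>
  Write \<open>r(\<beta>) = \<bar>\<beta> - \<beta>\<^sup>\<sigma>\<bar>\<close> for a point \<open>\<beta>\<close> of the orbit, so that \<open>x\<close> is badly approximable when some
  \<open>\<epsilon> > 0\<close> satisfies \<open>\<bar>x - \<beta>\<bar> \<ge> \<epsilon> r(\<beta>)\<close> for all \<open>\<beta>\<close>.  Everything rests on one arithmetic fact: the orbit is
  \<^emph>\<open>separated\<close>, that is, \<open>r\<close> is bounded on it and \<open>\<bar>\<beta> - \<beta>'\<bar> \<ge> \<kappa> min (r(\<beta>)) (r(\<beta>'))\<close> for distinct \<open>\<beta>\<close>, \<open>\<beta>'\<close>
  and a constant \<open>\<kappa> > 0\<close>.  Indeed all points of the orbit are roots of quadratic forms with
  coefficients in one discrete ring \<open>L\<close> and with one discriminant \<open>\<Delta>\<close>, so \<open>r(\<beta>) = \<bar>\<Delta>\<bar>\<^bsup>1/2\<^esup> / \<bar>a\<bar>\<close> for the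
  leading coefficient \<open>a\<close>; and the resultant of two such forms without common root is a nonzero
  element of \<open>L\<close>, hence of absolute value at least 1, which bounds the product of the four differences
  of their roots from below (lemmas \<open>orbit_form\<close> and \<open>orbit_separated\<close>).  The ring is \<open>\<int>\<close> or
  \<open>\<int>[\<i> \<surd>d]\<close>; the algebraic integers of the field lie in it after multiplication by 2.

  Separation means that at most one \<open>\<beta>\<close> with \<open>r(\<beta>) \<ge> M \<rho>\<close> comes close to a given ball of radius \<open>\<rho>\<close>,
  where \<open>M\<close> depends on \<open>\<kappa>\<close> and the dimension only.  All the conclusions follow from this.

  \<^item> In the absolute game, Alice always blocks a ball around this single \<open>\<beta>\<close>.  As the radii decrease
    to 0, every \<open>\<beta>\<close> is dealt with at the first step where the ball is small compared to \<open>r(\<beta>)\<close>; by then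
    the radius is still comparable to \<open>r(\<beta>)\<close> (theorem \<open>separated_family_absolute_winning\<close>).

  \<^item> For the dimension, divide a cube again and again into \<open>R\<^sup>n\<close> cubes, and at every stage drop the
    cubes that meet the ball around the single dangerous \<open>\<beta>\<close> whose radius is the new scale.  A bounded
    number \<open>C\<close> of cubes is dropped each time, so that the limit set has dimension at least
    \<open>ln (R\<^sup>n - C) / ln R = n - O (1 / (R\<^sup>n ln R))\<close>.  A point \<open>\<beta>\<close> is dealt with when \<open>M \<rho> \<le> r(\<beta>) < M R \<rho>\<close>, and
    then it is kept at distance \<open>\<rho> / R \<ge> r(\<beta>) / (M R\<^sup>2)\<close>.  The admissible ratio is thus
    \<open>R = (M \<epsilon>)\<^bsup>-1/2\<^esup>\<close>, and \<open>\<epsilon> = e\<^bsup>-t\<^esup>\<close> gives the defect \<open>O (1 / (t e\<^bsup>nt/2\<^esup>))\<close>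
    (theorem \<open>separated_family_dimension\<close>).

  \<^item> For a prescribed value \<open>t\<close> in the complex case, the same construction is carried out on the circle of radius
    \<open>\<epsilon> r(\<beta>\<^sub>0)\<close> around \<open>\<beta>\<^sub>0\<close>.  Its points realise the value \<open>\<epsilon>\<close> at \<open>\<beta>\<^sub>0\<close>, and those that survive have no smaller
    value at any other \<open>\<beta>\<close>.  Other points \<open>\<beta>\<close> that threaten the circle have \<open>r(\<beta>)\<close> at most of the order of
    its radius, by separation from \<open>\<beta>\<^sub>0\<close>, which is what the construction needs at its first stage
    (theorem \<open>bad_dim_eq_lower_bound\<close>).
\<close>


section \<open>Trees and a lower bound for Hausdorff dimension\<close>

lemma term_le_suminf: "f i \<le> (\<Sum>i. f i)" for f :: "nat \<Rightarrow> ennreal"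
  using sum_le_suminf[OF summableI, of "{i}" f] by simp

text \<open>
  A counting version of the mass distribution principle.  Give each node of level \<open>k\<close> the mass
  \<open>1 / N\<^sup>k\<close> and let \<open>W k v\<close> be the mass of the forbidden nodes below \<open>v\<close>.  If \<open>W k v\<close> is less than the
  mass of \<open>v\<close>, then the same holds for one of the at least \<open>N\<close> children, because the forbidden mass
  of \<open>v\<close> is shared out among them.  The branch obtained in this way meets no forbidden node, since
  such a node has all of its mass forbidden.
\<close>
lemma branch_avoiding:
  fixes T :: "nat \<Rightarrow> 'v set" and par :: "'v \<Rightarrow> 'v" and N :: nat
    and H :: "nat \<Rightarrow> 'v set" and j :: "nat \<Rightarrow> nat" and C :: nat
  assumes T0: "T 0 = {v0}" and N: "N > 0"
    and fin: "\<And>k. finite (T k)"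
    and children: "\<And>k v. v \<in> T k \<Longrightarrow> N \<le> card {w \<in> T (Suc k). par w = v}"
    and H: "\<And>i. H i \<subseteq> T (j i)" "\<And>i. card (H i) \<le> C"
    and small: "(\<Sum>i. ennreal (real C / real N ^ j i)) < 1"
  shows "\<exists>v. (\<forall>k. v k \<in> T k) \<and> (\<forall>k. par (v (Suc k)) = v k) \<and> (\<forall>i. v (j i) \<notin> H i)"
proof -
  have finH: "finite (H i)" for i using H(1) fin finite_subset by blast
  \<comment> \<open>\<open>D k v i\<close> counts the nodes of \<open>H i\<close> below \<open>v\<close>; it is 0 once level \<open>j i\<close> has been passed.\<close>
  define D where "D k v i = (if k \<le> j i then card {w \<in> H i. (par ^^ (j i - k)) w = v} else 0)" for k v i
  define W where "W k v = (\<Sum>i. ennreal (real (D k v i) / real N ^ j i))" for k v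
  have D_children: "(\<Sum>w\<in>{w \<in> T (Suc k). par w = v}. D (Suc k) w i) \<le> D k v i" for k v i
  proof (cases "Suc k \<le> j i")
    case False
    then show ?thesis by (simp add: D_def)
  next
    case True
    then have e: "j i - k = Suc (j i - Suc k)" by simp
    have "(\<Sum>w\<in>{w \<in> T (Suc k). par w = v}. D (Suc k) w i)
        = (\<Sum>w\<in>{w \<in> T (Suc k). par w = v}. card {u \<in> H i. (par ^^ (j i - Suc k)) u = w})"
      using True by (simp add: D_def)
    also have "\<dots> = card (\<Union>w\<in>{w \<in> T (Suc k). par w = v}. {u \<in> H i. (par ^^ (j i - Suc k)) u = w})"
      by (rule card_UN_disjoint[symmetric]) (auto simp: fin finH)
    also have "\<dots> \<le> card {u \<in> H i. (par ^^ (j i - k)) u = v}"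
      by (rule card_mono) (auto simp: finH e)
    finally show ?thesis using True by (simp add: D_def)
  qed
  have W_children: "(\<Sum>w\<in>{w \<in> T (Suc k). par w = v}. W (Suc k) w) \<le> W k v" for k v
  proof -
    have "(\<Sum>w\<in>{w \<in> T (Suc k). par w = v}. W (Suc k) w)
       = (\<Sum>i. \<Sum>w\<in>{w \<in> T (Suc k). par w = v}. ennreal (real (D (Suc k) w i) / real N ^ j i))"
      unfolding W_def by (rule suminf_sum[symmetric]) auto
    also have "\<dots> \<le> W k v"
      unfolding W_def
    proof (rule suminf_le)
      fix i
      have "(\<Sum>w\<in>{w \<in> T (Suc k). par w = v}. ennreal (real (D (Suc k) w i) / real N ^ j i))
          = ennreal (real (\<Sum>w\<in>{w \<in> T (Suc k). par w = v}. D (Suc k) w i) / real N ^ j i)"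
        by (subst sum_ennreal) (auto simp: sum_divide_distrib)
      also have "\<dots> \<le> ennreal (real (D k v i) / real N ^ j i)"
        using D_children[where k=k and v=v and i=i]
        by (intro ennreal_leI divide_right_mono of_nat_mono) auto
      finally show "(\<Sum>w\<in>{w \<in> T (Suc k). par w = v}. ennreal (real (D (Suc k) w i) / real N ^ j i)) \<le> \<dots>" .
    qed auto
    finally show ?thesis .
  qed
  have step: "\<exists>w. (w \<in> T (Suc k) \<and> W (Suc k) w < ennreal (1 / real N ^ Suc k)) \<and> par w = v"
    if v: "v \<in> T k" "W k v < ennreal (1 / real N ^ k)" for k v
  proof (rule ccontr)
    assume "\<not> ?thesis"
    then have *: "ennreal (1 / real N ^ Suc k) \<le> W (Suc k) w" if "w \<in> {w \<in> T (Suc k). par w = v}" for w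
      using that by (auto simp: not_less)
    have "ennreal (1 / real N ^ k) = ennreal (real N * (1 / real N ^ Suc k))"
      using N by simp
    also have "\<dots> \<le> ennreal (real (card {w \<in> T (Suc k). par w = v}) * (1 / real N ^ Suc k))"
      using children[OF v(1)] by (intro ennreal_leI mult_right_mono) auto
    also have "\<dots> = (\<Sum>w\<in>{w \<in> T (Suc k). par w = v}. ennreal (1 / real N ^ Suc k))"
      by (subst sum_ennreal) auto
    also have "\<dots> \<le> (\<Sum>w\<in>{w \<in> T (Suc k). par w = v}. W (Suc k) w)"
      by (rule sum_mono) (rule *)
    also have "\<dots> \<le> W k v" by (rule W_children)
    finally show False using v(2) by simp
  qed
  have "W 0 v0 \<le> (\<Sum>i. ennreal (real C / real N ^ j i))"
    unfolding W_def
  proof (rule suminf_le)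
    fix i
    have "D 0 v0 i \<le> card (H i)" unfolding D_def by (auto intro!: card_mono simp: finH)
    also have "\<dots> \<le> C" by (rule H)
    finally show "ennreal (real (D 0 v0 i) / real N ^ j i) \<le> ennreal (real C / real N ^ j i)"
      by (intro ennreal_leI divide_right_mono of_nat_mono) auto
  qed auto
  then have W0: "W 0 v0 < ennreal (1 / real N ^ 0)"
    using small by simp
  have "\<exists>v. \<forall>k. (v k \<in> T k \<and> W k (v k) < ennreal (1 / real N ^ k)) \<and> par (v (Suc k)) = v k"
  proof (rule dependent_nat_choice)
    show "\<exists>x. x \<in> T 0 \<and> W 0 x < ennreal (1 / real N ^ 0)" using T0 W0 by auto
  qed (use step in blast)
  then obtain v where v: "\<And>k. v k \<in> T k" "\<And>k. W k (v k) < ennreal (1 / real N ^ k)"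
      "\<And>k. par (v (Suc k)) = v k" by blast
  have "v (j i) \<notin> H i" for i
  proof
    assume "v (j i) \<in> H i"
    then have "{v (j i)} \<subseteq> {w \<in> H i. (par ^^ (j i - j i)) w = v (j i)}" by auto
    then have "card {v (j i)} \<le> card {w \<in> H i. (par ^^ (j i - j i)) w = v (j i)}"
      by (intro card_mono) (auto simp: finH)
    then have "1 \<le> D (j i) (v (j i)) i" by (simp add: D_def)
    then have "ennreal (1 / real N ^ j i) \<le> ennreal (real (D (j i) (v (j i)) i) / real N ^ j i)"
      by (intro ennreal_leI divide_right_mono) auto
    also have "\<dots> \<le> W (j i) (v (j i))"
      unfolding W_def
      by (rule term_le_suminf)
    finally show False using v(2)[of "j i"] by simp
  qed
  with v show ?thesis by blast
qed

lemma hausdorff_measure_zeroE: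
  assumes "hausdorff_measure s E = 0" "\<delta> > 0" "\<eta> > 0"
  obtains U :: "nat \<Rightarrow> 'a::metric_space set"
    where "\<And>i. bounded (U i)" "\<And>i. diameter (U i) \<le> \<delta>" "E \<subseteq> (\<Union>i. U i)"
      "(\<Sum>i. ennreal (diameter (U i) powr s)) < ennreal \<eta>"
proof -
  have "hausdorff_premeasure \<delta> s E \<le> hausdorff_measure s E"
    unfolding hausdorff_measure_def using assms by (intro SUP_upper) auto
  with assms have "hausdorff_premeasure \<delta> s E < ennreal \<eta>" by simp
  then show ?thesis
    unfolding hausdorff_premeasure_def INF_less_iff using that by blast
qed

lemma hausdorff_dim_mono: "E \<subseteq> F \<Longrightarrow> hausdorff_dim E \<le> hausdorff_dim F"
proof -
  assume EF: "E \<subseteq> F"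
  have "hausdorff_premeasure \<delta> s E \<le> hausdorff_premeasure \<delta> s F" for \<delta> s
    unfolding hausdorff_premeasure_def by (rule INF_superset_mono) (use EF in auto)
  then have "hausdorff_measure s E \<le> hausdorff_measure s F" for s
    unfolding hausdorff_measure_def by (intro SUP_mono) auto
  then show ?thesis
    unfolding hausdorff_dim_def by (intro Inf_superset_mono Collect_mono ex_mono impI conj_mono) (simp_all, metis le_zero_eq)
qed

lemma hausdorff_dim_geI:
  assumes "\<And>s. s > 0 \<Longrightarrow> hausdorff_measure s E = 0 \<Longrightarrow> D \<le> s"
  shows "ereal D \<le> hausdorff_dim E"
  unfolding hausdorff_dim_def by (rule Inf_greatest) (use assms in auto)

lemma hausdorff_dim_empty_le: "s > 0 \<Longrightarrow> hausdorff_dim ({} :: 'a::metric_space set) \<le> ereal s"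
proof -
  assume s: "s > 0"
  have "hausdorff_premeasure \<delta> s ({} :: 'a set) = 0" if "\<delta> > 0" for \<delta>
  proof -
    have "hausdorff_premeasure \<delta> s ({} :: 'a set) \<le> (\<Sum>i. ennreal (diameter ({} :: 'a set) powr s))"
      unfolding hausdorff_premeasure_def using that by (intro INF_lower2[of "\<lambda>_. {}"]) auto
    then show ?thesis by simp
  qed
  then have "hausdorff_measure s ({} :: 'a set) = 0"
    unfolding hausdorff_measure_def by (simp add: SUP_constant)
  with s show ?thesis unfolding hausdorff_dim_def by (intro Inf_lower) auto
qed

lemma scale_index:
  fixes R :: real
  assumes "R > 1" "0 < d" "d \<le> \<rho>"
  shows "\<exists>j. \<rho> / R ^ Suc j < d \<and> d \<le> \<rho> / R ^ j"
proof -
  have "\<exists>n. \<rho> / d < R ^ n" using assms(1) real_arch_pow by blast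
  then have ex: "\<exists>n. \<rho> / R ^ n < d" using assms by (auto simp: field_simps)
  define n where "n = (LEAST n. \<rho> / R ^ n < d)"
  have n: "\<rho> / R ^ n < d" unfolding n_def using ex by (rule LeastI_ex)
  with assms have "n \<noteq> 0" by (cases n) auto
  then obtain j where j: "n = Suc j" by (cases n) auto
  have "\<not> \<rho> / R ^ j < d" using not_less_Least[of j "\<lambda>n. \<rho> / R ^ n < d"] j n_def by simp
  with n j show ?thesis by (auto simp: not_less)
qed

text \<open>
  With \<open>N\<close> children per node and cells shrinking by the factor \<open>R\<close>, the limit set has dimension at least
  \<open>ln N / ln R\<close>.  A set of a cover whose diameter is about \<open>\<rho> / R\<^sup>j\<close> meets at most \<open>C\<close> cells of level \<open>j\<close>,
  and these have total mass \<open>C / N\<^sup>j\<close>, which is at most a constant times the \<open>s\<close>-th power of the diameter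
  when \<open>R\<^sup>s \<le> N\<close>.  If the sum of these powers is small, there is a branch whose cells avoid
  all the sets of the cover, and the point on it is not covered.
\<close>
theorem tree_dimension_lower_bound:
  fixes T :: "nat \<Rightarrow> 'v set" and par :: "'v \<Rightarrow> 'v" and N C :: nat and R \<rho> :: real
    and cell :: "nat \<Rightarrow> 'v \<Rightarrow> 'a::metric_space set"
  assumes T0: "T 0 = {v0}" and N: "N \<ge> 2" and R: "R > 1" and \<rho>: "\<rho> > 0"
    and fin: "\<And>k. finite (T k)"
    and children: "\<And>k v. v \<in> T k \<Longrightarrow> N \<le> card {w \<in> T (Suc k). par w = v}"
    and overlap: "\<And>k U. bounded U \<Longrightarrow> diameter U \<le> \<rho> / R ^ k \<Longrightarrow> card {w \<in> T k. cell k w \<inter> U \<noteq> {}} \<le> C"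
    and branch: "\<And>v. (\<And>k. v k \<in> T k) \<Longrightarrow> (\<And>k. par (v (Suc k)) = v k) \<Longrightarrow> \<exists>x\<in>E. \<forall>k. x \<in> cell k (v k)"
  shows "ereal (ln N / ln R) \<le> hausdorff_dim E"
proof (rule hausdorff_dim_geI)
  fix s :: real
  assume s: "s > 0" and zero: "hausdorff_measure s E = 0"
  show "ln N / ln R \<le> s"
  proof (rule ccontr)
    assume "\<not> ln N / ln R \<le> s"
    then have "s * ln R < ln N" using R by (simp add: field_simps)
    then have "exp (s * ln R) \<le> exp (ln N)" by simp
    then have RN: "R powr s \<le> N" using R N by (simp add: powr_def)
    \<comment> \<open>\<open>q\<close> is the constant in \<open>1 / N\<^sup>j \<le> q diam\<^sup>s\<close>; the summand \<open>\<eta> / 2\<^bsup>i+1\<^esup>\<close> below takes care of the sets of diameter 0,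
        which have weight 0 and may be placed at any level.\<close>
    define q where "q = (R / \<rho>) powr s"
    have q: "q > 0" using R \<rho> by (simp add: q_def)
    define \<eta> where "\<eta> = 1 / (2 * (real C + 1) * (q + 1))"
    have \<eta>: "\<eta> > 0" using q by (simp add: \<eta>_def)
    obtain U where U: "\<And>i. bounded (U i)" "\<And>i. diameter (U i) \<le> \<rho>" "E \<subseteq> (\<Union>i. U i)"
      "(\<Sum>i. ennreal (diameter (U i) powr s)) < ennreal \<eta>"
      using hausdorff_measure_zeroE[OF zero \<rho> \<eta>] by metis
    have "\<exists>j. diameter (U i) \<le> \<rho> / R ^ j \<and> 1 / real N ^ j \<le> q * diameter (U i) powr s + \<eta> * (1/2) ^ Suc i" for i
    proof (cases "diameter (U i) = 0")
      case True
      have "\<exists>j. 1 / (\<eta> * (1/2) ^ Suc i) < real N ^ j"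
        using N by (intro real_arch_pow) auto
      then obtain j where "1 / (\<eta> * (1/2) ^ Suc i) < real N ^ j" by blast
      then have "1 / real N ^ j \<le> \<eta> * (1/2) ^ Suc i" using \<eta> N by (simp add: field_simps)
      then show ?thesis using True R \<rho> by (intro exI[of _ j]) auto
    next
      case False
      then have pos: "diameter (U i) > 0" using diameter_ge_0[OF U(1)[of i]] by simp
      obtain j where j: "\<rho> / R ^ Suc j < diameter (U i)" "diameter (U i) \<le> \<rho> / R ^ j"
        using scale_index[OF R pos U(2)] by blast
      have "R powr (s * real j) = (R powr s) ^ j"
        using R by (simp add: powr_powr[symmetric] powr_realpow)
      also have "\<dots> \<le> real N ^ j" using RN by (intro power_mono) auto
      finally have "1 / real N ^ j \<le> 1 / (R powr (s * real j))"
        using R N by (intro divide_left_mono) auto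
      also have "\<dots> = q * (\<rho> / R ^ Suc j) powr s"
      proof -
        have "q * (\<rho> / R ^ Suc j) powr s = ((R / \<rho>) * (\<rho> / R ^ Suc j)) powr s"
          unfolding q_def using R \<rho> by (subst powr_mult[symmetric]) auto
        also have "(R / \<rho>) * (\<rho> / R ^ Suc j) = 1 / R ^ j" using R \<rho> by simp
        also have "(1 / R ^ j) powr s = 1 / (R powr (s * real j))"
        proof -
          have "R ^ j = R powr real j" using R by (simp add: powr_realpow)
          then show ?thesis by (simp add: powr_divide powr_powr mult.commute)
        qed
        finally show ?thesis by simp
      qed
      also have "\<dots> \<le> q * diameter (U i) powr s"
        using j(1) R \<rho> q s by (intro mult_left_mono powr_mono2) auto
      finally show ?thesis using j(2) \<eta> by (intro exI[of _ j]) (auto intro: add_increasing2)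
    qed
    then obtain j where j: "\<And>i. diameter (U i) \<le> \<rho> / R ^ j i"
      "\<And>i. 1 / real N ^ j i \<le> q * diameter (U i) powr s + \<eta> * (1/2) ^ Suc i"
      by metis
    have "(\<Sum>i. ennreal (real C / real N ^ j i)) \<le>
        (\<Sum>i. ennreal (C * q) * ennreal (diameter (U i) powr s) + ennreal (C * \<eta> * (1/2) ^ Suc i))"
    proof (rule suminf_le)
      fix i
      have "real C / real N ^ j i = C * (1 / real N ^ j i)" by simp
      also have "\<dots> \<le> C * (q * diameter (U i) powr s + \<eta> * (1/2) ^ Suc i)"
        by (intro mult_left_mono j) auto
      also have "\<dots> = C * q * diameter (U i) powr s + C * \<eta> * (1/2) ^ Suc i"
        by (simp add: algebra_simps)
      finally have "ennreal (real C / real N ^ j i) \<le> ennreal (C * q * diameter (U i) powr s + C * \<eta> * (1/2) ^ Suc i)"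
        by (rule ennreal_leI)
      then show "ennreal (real C / real N ^ j i) \<le>
          ennreal (C * q) * ennreal (diameter (U i) powr s) + ennreal (C * \<eta> * (1/2) ^ Suc i)"
        using q \<eta> by (simp add: ennreal_plus ennreal_mult)
    qed auto
    also have "\<dots> = ennreal (C * q) * (\<Sum>i. ennreal (diameter (U i) powr s)) + (\<Sum>i. ennreal (C * \<eta> * (1/2) ^ Suc i))"
      by (simp add: suminf_add[symmetric] ennreal_suminf_cmult)
    also have "(\<Sum>i. ennreal (C * \<eta> * (1/2) ^ Suc i)) = ennreal (C * \<eta>)"
    proof (rule suminf_ennreal_eq)
      show "(\<lambda>i. C * \<eta> * (1/2) ^ Suc i) sums (C * \<eta>)"
        using sums_mult[OF power_half_series, of "C * \<eta>"] by simp
    qed (use \<eta> in auto)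
    also have "ennreal (C * q) * (\<Sum>i. ennreal (diameter (U i) powr s)) + ennreal (C * \<eta>)
        \<le> ennreal (C * q) * ennreal \<eta> + ennreal (C * \<eta>)"
      using U(4) by (intro add_mono mult_left_mono) auto
    also have "\<dots> = ennreal (C * (q + 1) * \<eta>)"
      using q \<eta> by (simp add: ennreal_mult[symmetric] ennreal_plus[symmetric] algebra_simps del: ennreal_plus)
    also have "\<dots> < 1"
    proof -
      have "C * (q + 1) * \<eta> = real C / (2 * (real C + 1))"
        using q by (simp add: \<eta>_def divide_simps add_pos_pos) 
      also have "\<dots> < 1" by (simp add: field_simps)
      finally show ?thesis by (simp add: ennreal_less_one_iff)
    qed
    finally have small: "(\<Sum>i. ennreal (real C / real N ^ j i)) < 1" .
    let ?H = "\<lambda>i. {w \<in> T (j i). cell (j i) w \<inter> U i \<noteq> {}}"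
    have "\<exists>v. (\<forall>k. v k \<in> T k) \<and> (\<forall>k. par (v (Suc k)) = v k) \<and> (\<forall>i. v (j i) \<notin> ?H i)"
      by (rule branch_avoiding[of T v0 N par ?H j C, OF T0 _ fin children _ overlap[OF U(1) j(1)] small])
        (use N in auto)
    then obtain v where v: "\<And>k. v k \<in> T k" "\<And>k. par (v (Suc k)) = v k"
        "\<And>i. v (j i) \<notin> ?H i"
      by blast
    obtain x where x: "x \<in> E" "\<And>k. x \<in> cell k (v k)" using branch v by metis
    obtain i where "x \<in> U i" using U(3) x(1) by blast
    with v(1,3) x(2) show False by blast
  qed
qed


section \<open>Grid cubes with one ball removed per cube\<close>

text \<open>
  The cubes of side \<open>R\<^bsup>-k\<^esup>\<close> into which the unit cube is divided are indexed by the functions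
  from the basis to \<open>{..<R\<^sup>k}\<close> that give the coordinates of the lowest corner in units of \<open>R\<^bsup>-k\<^esup>\<close>.
  Indices are extensional, so that distinct indices belong to distinct cubes and can be counted.
\<close>
definition grid_nodes :: "nat \<Rightarrow> nat \<Rightarrow> ('b::euclidean_space \<Rightarrow> nat) set" where
  "grid_nodes R k = (Basis \<rightarrow>\<^sub>E {..<R ^ k})"

definition grid_parent :: "nat \<Rightarrow> ('b::euclidean_space \<Rightarrow> nat) \<Rightarrow> ('b \<Rightarrow> nat)" where
  "grid_parent R v = (\<lambda>b\<in>Basis. v b div R)"

definition grid_cube :: "nat \<Rightarrow> nat \<Rightarrow> ('b::euclidean_space \<Rightarrow> nat) \<Rightarrow> 'b set" where
  "grid_cube R k v =
     {s. \<forall>b\<in>Basis. real (v b) / real R ^ k \<le> s \<bullet> b \<and> s \<bullet> b \<le> (real (v b) + 1) / real R ^ k}"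

lemma finite_grid_nodes: "finite (grid_nodes R k :: ('b::euclidean_space \<Rightarrow> nat) set)"
  unfolding grid_nodes_def by (intro finite_PiE) auto

lemma grid_nodes_0: "grid_nodes R 0 = {\<lambda>b\<in>Basis. 0}"
  unfolding grid_nodes_def by (auto simp: PiE_def Pi_def extensional_def restrict_def)

lemma card_grid_children:
  fixes v :: "'b::euclidean_space \<Rightarrow> nat"
  assumes "R > 0" "v \<in> grid_nodes R k"
  shows "R ^ DIM('b) \<le> card {w \<in> grid_nodes R (Suc k). grid_parent R w = v}"
proof -
  have "Pi\<^sub>E Basis (\<lambda>b. {v b * R..<v b * R + R}) \<subseteq> {w \<in> grid_nodes R (Suc k). grid_parent R w = v}"
  proof (intro subsetI CollectI conjI)
    fix w assume w: "w \<in> Pi\<^sub>E Basis (\<lambda>b. {v b * R..<v b * R + R})"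
    show "w \<in> grid_nodes R (Suc k)"
      unfolding grid_nodes_def
    proof (rule PiE_I)
      fix b :: 'b assume b: "b \<in> Basis"
      have "v b + 1 \<le> R ^ k" using assms(2) b by (auto simp: grid_nodes_def PiE_iff Suc_le_eq)
      then have "(v b + 1) * R \<le> R ^ k * R" by (rule mult_le_mono1)
      moreover have "w b < v b * R + R" using w b by (auto simp: PiE_iff)
      ultimately show "w b \<in> {..<R ^ Suc k}" by (simp add: algebra_simps)
    qed (use w in \<open>auto simp: PiE_iff extensional_def\<close>)
    have "w b div R = v b" if "b \<in> Basis" for b
      using w that assms(1) by (intro div_nat_eqI) (auto simp: PiE_iff algebra_simps)
    then show "grid_parent R w = v"
      using assms(2) by (auto simp: grid_parent_def grid_nodes_def PiE_iff extensional_def fun_eq_iff)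
  qed
  then have "card (Pi\<^sub>E Basis (\<lambda>b. {v b * R..<v b * R + R})) \<le>
      card {w \<in> grid_nodes R (Suc k). grid_parent R w = v}"
    by (intro card_mono) (auto simp: finite_grid_nodes)
  then show ?thesis by (simp add: card_PiE)
qed

lemma grid_cube_eq_cbox:
  "grid_cube R k v = cbox (\<Sum>b\<in>Basis. (real (v b) / real R ^ k) *\<^sub>R b)
     (\<Sum>b\<in>Basis. ((real (v b) + 1) / real R ^ k) *\<^sub>R b)"
  unfolding grid_cube_def by (auto simp: mem_box)

lemma compact_grid_cube: "compact (grid_cube R k v)"
  unfolding grid_cube_eq_cbox by (rule compact_cbox)

lemma grid_cube_nonempty: "grid_cube R k v \<noteq> {}"
proof -
  have "(\<Sum>b\<in>Basis. (real (v b) / real R ^ k) *\<^sub>R b) \<in> grid_cube R k v"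
    by (simp add: grid_cube_def divide_right_mono)
  then show ?thesis by blast
qed

lemma grid_cube_subset_parent:
  assumes "R > 0"
  shows "grid_cube R (Suc k) w \<subseteq> grid_cube R k (grid_parent R w)"
proof
  fix s assume s: "s \<in> grid_cube R (Suc k) w"
  show "s \<in> grid_cube R k (grid_parent R w)"
    unfolding grid_cube_def
  proof (intro CollectI ballI conjI)
    fix b :: 'a assume b: "b \<in> Basis"
    have d: "w b div R * R \<le> w b" "w b + 1 \<le> (w b div R + 1) * R"
      using assms by (auto simp: Suc_le_eq dividend_less_div_times)
    have "real (w b div R) / real R ^ k = real (w b div R * R) / real R ^ Suc k"
      using assms by simp
    also have "\<dots> \<le> real (w b) / real R ^ Suc k"
      by (intro divide_right_mono of_nat_mono d(1)) simp
    also have "\<dots> \<le> s \<bullet> b" using s b by (auto simp: grid_cube_def)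
    finally show "real (grid_parent R w b) / real R ^ k \<le> s \<bullet> b" using b by (simp add: grid_parent_def)
    have "s \<bullet> b \<le> (real (w b) + 1) / real R ^ Suc k" using s b by (auto simp: grid_cube_def)
    also have "\<dots> = real (w b + 1) / real R ^ Suc k" by simp
    also have "\<dots> \<le> real ((w b div R + 1) * R) / real R ^ Suc k"
      by (intro divide_right_mono of_nat_mono d(2)) simp
    also have "\<dots> = (real (w b div R) + 1) / real R ^ k"
      using assms by (simp add: field_simps)
    finally show "s \<bullet> b \<le> (real (grid_parent R w b) + 1) / real R ^ k" using b by (simp add: grid_parent_def)
  qed
qed

lemma grid_cube_subset_unit:
  assumes "v \<in> grid_nodes R k" "R > 0"
  shows "grid_cube R k v \<subseteq> cbox 0 One"
proof
  fix s assume s: "s \<in> grid_cube R k v"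
  show "s \<in> cbox 0 One"
    unfolding mem_box
  proof (intro ballI conjI)
    fix b :: 'a assume b: "b \<in> Basis"
    have "0 \<le> real (v b) / real R ^ k" by simp
    also have "\<dots> \<le> s \<bullet> b" using s b by (auto simp: grid_cube_def)
    finally show "0 \<bullet> b \<le> s \<bullet> b" by simp
    have "Suc (v b) \<le> R ^ k" using assms(1) b by (auto simp: grid_nodes_def PiE_iff Suc_le_eq)
    then have "real (Suc (v b)) \<le> real (R ^ k)" by (rule of_nat_mono)
    then have "(real (v b) + 1) / real R ^ k \<le> 1" using assms(2) by (simp add: field_simps)
    moreover have "s \<bullet> b \<le> (real (v b) + 1) / real R ^ k" using s b by (auto simp: grid_cube_def)
    ultimately show "s \<bullet> b \<le> One \<bullet> b" using b by simp
  qed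
qed

lemma norm_diff_grid_cube:
  fixes s t :: "'b::euclidean_space"
  assumes "s \<in> grid_cube R k v" "t \<in> grid_cube R k v"
  shows "norm (s - t) \<le> real DIM('b) / real R ^ k"
proof -
  have "norm (s - t) \<le> (\<Sum>b\<in>Basis. \<bar>(s - t) \<bullet> b\<bar>)" by (rule norm_le_l1)
  also have "\<dots> \<le> (\<Sum>b\<in>(Basis :: 'b set). 1 / real R ^ k)"
  proof (rule sum_mono)
    fix b :: 'b assume b: "b \<in> Basis"
    have "real (v b) / real R ^ k + 1 / real R ^ k = (real (v b) + 1) / real R ^ k"
      by (simp add: add_divide_distrib)
    with assms b show "\<bar>(s - t) \<bullet> b\<bar> \<le> 1 / real R ^ k"
      by (force simp: grid_cube_def inner_diff_left abs_le_iff)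
  qed
  finally show ?thesis by simp
qed

lemma grid_branch_point:
  assumes "R > 0" "\<And>k. grid_parent R (v (Suc k)) = v k"
  shows "\<exists>s. \<forall>k. s \<in> grid_cube R k (v k)"
proof -
  have "(\<Inter>k. grid_cube R k (v k)) \<noteq> {}"
  proof (rule compact_nest)
    show "grid_cube R n (v n) \<subseteq> grid_cube R m (v m)" if "m \<le> n" for m n
    proof (rule lift_Suc_antimono_le[OF _ that])
      show "grid_cube R (Suc k) (v (Suc k)) \<subseteq> grid_cube R k (v k)" for k
        using grid_cube_subset_parent[OF assms(1), of k "v (Suc k)"] assms(2) by simp
    qed
  qed (auto simp: compact_grid_cube grid_cube_nonempty)
  then show ?thesis by blast
qed

text \<open>
  How many image cubes of one level can meet a set of diameter at most twice the scale of that level, when the map \<open>\<phi>\<close>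
  contracts the scaled distances at most by the factor \<open>\<mu>\<close>: each coordinate of the index ranges over an
  interval of integers of half-length \<open>2 / \<mu> + 1\<close>, rounded up.
\<close>
definition overlap_bound :: "real \<Rightarrow> nat \<Rightarrow> nat" where
  "overlap_bound \<mu> n = (2 * nat \<lceil>2 / \<mu> + 1\<rceil> + 1) ^ n"

lemma grid_overlap:
  fixes \<phi> :: "'b::euclidean_space \<Rightarrow> 'a::metric_space"
  assumes R: "R > 0" and \<rho>: "\<rho> > 0" and \<mu>: "\<mu> > 0"
    and lower: "\<And>s t. s \<in> cbox 0 One \<Longrightarrow> t \<in> cbox 0 One \<Longrightarrow> \<mu> * \<rho> * norm (s - t) \<le> dist (\<phi> s) (\<phi> t)"
    and U: "bounded U" "diameter U \<le> 2 * \<rho> / real R ^ k"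
  shows "card {w \<in> grid_nodes R k. \<phi> ` grid_cube R k w \<inter> U \<noteq> {}} \<le> overlap_bound \<mu> DIM('b)"
proof (cases "{w \<in> grid_nodes R k. \<phi> ` grid_cube R k w \<inter> U \<noteq> {}} = {}")
  case True
  then show ?thesis by (metis card.empty le0)
next
  case False
  define m where "m = nat \<lceil>2 / \<mu> + 1\<rceil>"
  have m: "2 / \<mu> + 1 \<le> real m" using \<mu> unfolding m_def by linarith
  obtain w0 s0 where w0: "w0 \<in> grid_nodes R k" "s0 \<in> grid_cube R k w0" "\<phi> s0 \<in> U"
    using False by blast
  have "{w \<in> grid_nodes R k. \<phi> ` grid_cube R k w \<inter> U \<noteq> {}} \<subseteq> Pi\<^sub>E Basis (\<lambda>b. {w0 b - m..w0 b + m})"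
  proof
    fix w assume "w \<in> {w \<in> grid_nodes R k. \<phi> ` grid_cube R k w \<inter> U \<noteq> {}}"
    then obtain s where w: "w \<in> grid_nodes R k" "s \<in> grid_cube R k w" "\<phi> s \<in> U" by blast
    have "\<mu> * \<rho> * norm (s - s0) \<le> dist (\<phi> s) (\<phi> s0)"
      using w w0 grid_cube_subset_unit[OF _ R] by (intro lower) blast+
    also have "\<dots> \<le> 2 * \<rho> / real R ^ k"
      using diameter_bounded_bound[OF U(1) w(3) w0(3)] U(2) by simp
    finally have "norm (s - s0) \<le> (2 / \<mu>) / real R ^ k"
      using \<mu> \<rho> R by (simp add: field_simps)
    then have n: "real R ^ k * norm (s - s0) \<le> 2 / \<mu>"
      using R \<mu> by (simp add: field_simps)
    show "w \<in> Pi\<^sub>E Basis (\<lambda>b. {w0 b - m..w0 b + m})"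
    proof (rule PiE_I)
      fix b :: 'b assume b: "b \<in> Basis"
      have "real R ^ k * \<bar>s \<bullet> b - s0 \<bullet> b\<bar> \<le> real R ^ k * norm (s - s0)"
        using Basis_le_norm[OF b, of "s - s0"] by (intro mult_left_mono) (auto simp: inner_diff_left)
      with n have d: "\<bar>real R ^ k * (s \<bullet> b) - real R ^ k * (s0 \<bullet> b)\<bar> \<le> 2 / \<mu>"
        by (simp add: abs_mult right_diff_distrib[symmetric])
      have "real (w b) \<le> real R ^ k * (s \<bullet> b)" "real R ^ k * (s \<bullet> b) \<le> real (w b) + 1"
          "real (w0 b) \<le> real R ^ k * (s0 \<bullet> b)" "real R ^ k * (s0 \<bullet> b) \<le> real (w0 b) + 1"
        using w(2) w0(2) b R by (auto simp: grid_cube_def field_simps)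
      with d m have "real (w b) \<le> real (w0 b + m)" "real (w0 b) \<le> real (w b + m)"
        by (auto simp: abs_le_iff)
      then show "w b \<in> {w0 b - m..w0 b + m}" unfolding of_nat_le_iff by auto
    qed (use w(1) in \<open>auto simp: grid_nodes_def PiE_iff extensional_def\<close>)
  qed
  then have "card {w \<in> grid_nodes R k. \<phi> ` grid_cube R k w \<inter> U \<noteq> {}}
      \<le> card (Pi\<^sub>E Basis (\<lambda>b::'b. {w0 b - m..w0 b + m}))"
    by (intro card_mono finite_PiE) auto
  also have "\<dots> = (\<Prod>b\<in>(Basis :: 'b set). card {w0 b - m..w0 b + m})" by (simp add: card_PiE)
  also have "\<dots> \<le> (\<Prod>b\<in>(Basis :: 'b set). 2 * m + 1)" by (intro prod_mono) auto
  also have "\<dots> = overlap_bound \<mu> DIM('b)" by (simp add: overlap_bound_def m_def)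
  finally show ?thesis .
qed

text \<open>
  The point \<open>p k v\<close> is the centre of the one ball to be avoided inside the cube \<open>v\<close> of level \<open>k\<close>.  The radius of
  that ball is the scale of the next level.
\<close>
primrec pruned_nodes ::
  "('b::euclidean_space \<Rightarrow> 'a::metric_space) \<Rightarrow> (nat \<Rightarrow> ('b \<Rightarrow> nat) \<Rightarrow> 'a) \<Rightarrow> real \<Rightarrow> nat \<Rightarrow> nat \<Rightarrow> ('b \<Rightarrow> nat) set" where
  "pruned_nodes \<phi> p \<rho> R 0 = grid_nodes R 0"
| "pruned_nodes \<phi> p \<rho> R (Suc k) = {w \<in> grid_nodes R (Suc k). grid_parent R w \<in> pruned_nodes \<phi> p \<rho> R k \<and>
     \<phi> ` grid_cube R (Suc k) w \<inter> ball (p k (grid_parent R w)) (\<rho> / real R ^ Suc k) = {}}"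

lemma pruned_nodes_subset: "pruned_nodes \<phi> p \<rho> R k \<subseteq> grid_nodes R k"
  by (cases k) auto

text \<open>
  Both the number of children lost to the ball around \<open>p k v\<close> and the number of cells that meet a set of a
  cover are instances of the same overlap bound; hence the constant \<open>C\<close> occurs in both roles.
\<close>
lemma pruned_grid_dimension:
  fixes \<phi> :: "'b::euclidean_space \<Rightarrow> 'a::metric_space" and p :: "nat \<Rightarrow> ('b \<Rightarrow> nat) \<Rightarrow> 'a"
  assumes R: "R \<ge> 2" and \<rho>: "\<rho> > 0" and \<mu>: "\<mu> > 0"
    and lower: "\<And>s t. s \<in> cbox 0 One \<Longrightarrow> t \<in> cbox 0 One \<Longrightarrow> \<mu> * \<rho> * norm (s - t) \<le> dist (\<phi> s) (\<phi> t)"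
    and big: "overlap_bound \<mu> DIM('b) + 2 \<le> R ^ DIM('b)"
    and E: "\<And>v s. (\<And>k. v k \<in> grid_nodes R k) \<Longrightarrow> (\<And>k. s \<in> grid_cube R k (v k)) \<Longrightarrow>
        (\<And>k. \<rho> / real R ^ Suc k \<le> dist (p k (v k)) (\<phi> s)) \<Longrightarrow> \<phi> s \<in> E"
  shows "ereal (ln (real (R ^ DIM('b) - overlap_bound \<mu> DIM('b))) / ln (real R)) \<le> hausdorff_dim E"
proof (rule tree_dimension_lower_bound[where T = "pruned_nodes \<phi> p \<rho> R" and par = "grid_parent R"
      and \<rho> = \<rho> and C = "overlap_bound \<mu> DIM('b)" and cell = "\<lambda>k v. \<phi> ` grid_cube R k v"])
  let ?T = "pruned_nodes \<phi> p \<rho> R"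
  let ?C = "overlap_bound \<mu> DIM('b)"
  show "?T 0 = {\<lambda>b\<in>Basis. 0}" by (simp add: grid_nodes_0)
  show fin: "finite (?T k)" for k
    by (rule finite_subset[OF pruned_nodes_subset finite_grid_nodes])
  show "2 \<le> R ^ DIM('b) - ?C" using big by simp
  show "1 < real R" using R by simp
  show "R ^ DIM('b) - ?C \<le> card {w \<in> ?T (Suc k). grid_parent R w = v}" if v: "v \<in> ?T k" for k v
  proof -
    let ?B = "ball (p k v) (\<rho> / real R ^ Suc k)"
    let ?hit = "{w \<in> grid_nodes R (Suc k). \<phi> ` grid_cube R (Suc k) w \<inter> ?B \<noteq> {}}"
    have "{w \<in> grid_nodes R (Suc k). grid_parent R w = v} - ?hit \<subseteq> {w \<in> ?T (Suc k). grid_parent R w = v}"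
      using v by auto
    then have "card ({w \<in> grid_nodes R (Suc k). grid_parent R w = v} - ?hit)
        \<le> card {w \<in> ?T (Suc k). grid_parent R w = v}"
      by (intro card_mono) (use fin[of "Suc k"] in \<open>rule rev_finite_subset; blast\<close>)
    moreover have "card {w \<in> grid_nodes R (Suc k). grid_parent R w = v} - card ?hit
        \<le> card ({w \<in> grid_nodes R (Suc k). grid_parent R w = v} - ?hit)"
      by (rule diff_card_le_card_Diff) (auto simp: finite_grid_nodes)
    moreover have "R ^ DIM('b) \<le> card {w \<in> grid_nodes R (Suc k). grid_parent R w = v}"
      using R subsetD[OF pruned_nodes_subset v] by (intro card_grid_children) auto
    moreover have "card ?hit \<le> ?C"
    proof (rule grid_overlap[OF _ \<rho> \<mu> lower])
      have "dist x y \<le> 2 * \<rho> / real R ^ Suc k" if "x \<in> ?B" "y \<in> ?B" for x y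
      proof -
        have "dist x y \<le> dist x (p k v) + dist y (p k v)" by (rule dist_triangle2)
        moreover have "dist x (p k v) < \<rho> / real R ^ Suc k" "dist y (p k v) < \<rho> / real R ^ Suc k"
          using that by (simp_all add: dist_commute del: power_Suc)
        moreover have "2 * \<rho> / real R ^ Suc k = \<rho> / real R ^ Suc k + \<rho> / real R ^ Suc k" by simp
        ultimately show ?thesis by linarith
      qed
      then show "diameter ?B \<le> 2 * \<rho> / real R ^ Suc k"
        using \<rho> R unfolding diameter_def by (auto intro!: cSUP_least)
    qed (use R in auto)
    ultimately show ?thesis by linarith
  qed
  show "card {w \<in> ?T k. \<phi> ` grid_cube R k w \<inter> U \<noteq> {}} \<le> ?C"
    if U: "bounded U" "diameter U \<le> \<rho> / real R ^ k" for k U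
  proof -
    have "\<rho> / real R ^ k \<le> 2 * \<rho> / real R ^ k" using \<rho> by (intro divide_right_mono) auto
    then have "card {w \<in> grid_nodes R k. \<phi> ` grid_cube R k w \<inter> U \<noteq> {}} \<le> ?C"
      using U R by (intro grid_overlap[OF _ \<rho> \<mu> lower]) auto
    moreover have "card {w \<in> ?T k. \<phi> ` grid_cube R k w \<inter> U \<noteq> {}}
        \<le> card {w \<in> grid_nodes R k. \<phi> ` grid_cube R k w \<inter> U \<noteq> {}}"
      by (intro card_mono) (auto simp: finite_grid_nodes intro: subsetD[OF pruned_nodes_subset])
    ultimately show ?thesis by simp
  qed
  show "\<exists>x\<in>E. \<forall>k. x \<in> \<phi> ` grid_cube R k (v k)"
    if v: "\<And>k. v k \<in> ?T k" "\<And>k. grid_parent R (v (Suc k)) = v k" for v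
  proof -
    obtain s where s: "\<And>k. s \<in> grid_cube R k (v k)"
      using grid_branch_point[of R v] v R by auto
    have "\<phi> s \<in> E"
    proof (rule E)
      show "v k \<in> grid_nodes R k" for k using subsetD[OF pruned_nodes_subset v(1)] .
      show "\<rho> / real R ^ Suc k \<le> dist (p k (v k)) (\<phi> s)" for k
        using v(1)[of "Suc k"] v(2)[of k] s[of "Suc k"] by (force simp: not_less)
    qed (rule s)
    then show ?thesis using s by blast
  qed
qed (rule \<rho>)


section \<open>Separated families of points\<close>

text \<open>
  The bound \<open>B\<close> on the sizes \<open>r\<close> makes it possible to start the constructions at some finite scale.
\<close>
locale separated_family =
  fixes P :: "'a::metric_space set" and r :: "'a \<Rightarrow> real" and \<kappa> B :: real
  assumes \<kappa>_pos: "\<kappa> > 0"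
    and r_pos: "p \<in> P \<Longrightarrow> 0 < r p"
    and r_le: "p \<in> P \<Longrightarrow> r p \<le> B"
    and separated: "p \<in> P \<Longrightarrow> q \<in> P \<Longrightarrow> p \<noteq> q \<Longrightarrow> \<kappa> * min (r p) (r q) \<le> dist p q"
begin

text \<open>
  The only form in which separation is used in games and Cantor constructions: at scale \<open>R\<close> there is
  at most one dangerous point nearby.
\<close>
lemma large_close_unique:
  assumes "p \<in> P" "q \<in> P" "R \<le> \<kappa> * r p" "R \<le> \<kappa> * r q" "dist p q < R"
  shows "p = q"
proof (rule ccontr)
  assume "p \<noteq> q"
  with separated assms have "\<kappa> * min (r p) (r q) \<le> dist p q" by blast
  moreover have "R \<le> \<kappa> * min (r p) (r q)" using assms by (auto simp: min_def)
  ultimately show False using assms(5) by simp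
qed

end

lemma separated_family_subset:
  assumes "separated_family P r \<kappa> B" "Q \<subseteq> P"
  shows "separated_family Q r \<kappa> B"
proof -
  interpret separated_family P r \<kappa> B by fact
  show ?thesis by unfold_locales (use assms(2) in \<open>auto intro: \<kappa>_pos r_pos r_le separated\<close>)
qed

section \<open>The absolute game for a separated family\<close>

text \<open>
  In a normed space, unlike in a general metric space, disjoint balls are as far apart as their radii
  suggest.  This is what forces Bob to shrink his balls.
\<close>
lemma dist_gt_of_disjoint_cballs:
  fixes x y :: "'a::real_normed_vector"
  assumes disj: "cball x a \<inter> cball y b = {}" and "a \<ge> 0" "b \<ge> 0"
  shows "a + b < dist x y"
proof (rule ccontr)
  assume "\<not> a + b < dist x y"
  then have le: "dist x y \<le> a + b" by simp
  show False
  proof (cases "dist x y \<le> a")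
    case True
    then have "y \<in> cball x a \<inter> cball y b" using assms(3) by simp
    then show False using disj by blast
  next
    case False
    define u where "u = a / dist x y"
    have d: "dist x y > 0" using False assms(2) by linarith
    then have u: "0 \<le> u" "u \<le> 1" using False assms(2) by (auto simp: u_def field_simps)
    define z where "z = x + u *\<^sub>R (y - x)"
    have "dist x z = u * dist x y"
      using u by (simp add: z_def dist_norm norm_minus_commute)
    then have 1: "dist x z = a" using d by (simp add: u_def)
    have "y - z = (1 - u) *\<^sub>R (y - x)" by (simp add: z_def algebra_simps)
    then have "dist y z = (1 - u) * dist x y"
      using u by (simp add: dist_norm norm_minus_commute)
    also have "\<dots> = dist x y - a" using d by (simp add: u_def algebra_simps)
    finally have "z \<in> cball x a \<inter> cball y b" using 1 le by simp
    then show False using disj by blast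
  qed
qed

text \<open>
  Alice blocks half of her allowance around the unique dangerous point near Bob's ball, and if there is
  none, around the centre of that ball.  In both cases the blocked ball is centred within
  \<open>(1 + b / 8) \<rho>\<close> of Bob's centre and has radius \<open>b \<rho> / 2\<close>, which cuts so deeply into Bob's ball that the next radius is
  at most \<open>(1 - 3 b / 16) \<rho>\<close>.  So the radii tend to 0, and each \<open>p\<close> is large compared to some ball.
\<close>
theorem separated_family_absolute_winning:
  fixes P :: "'a::euclidean_space set"
  assumes "separated_family P r \<kappa> B" and b: "0 < b" "b < 1"
  shows "beta_absolute_winning b UNIV {x. \<exists>\<epsilon>>0. \<forall>p\<in>P. \<epsilon> * r p \<le> dist x p}"
proof -
  interpret separated_family P r \<kappa> B by fact
  \<comment> \<open>Two targets near a ball of radius \<open>\<rho>\<close> are at distance less than \<open>4 \<rho> = \<kappa> m \<rho>\<close>, so they coincide.\<close>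
  define m where "m = 4 / \<kappa>"
  have m: "m > 0" using \<kappa>_pos by (simp add: m_def)
  define target where
    "target x \<rho> p \<longleftrightarrow> p \<in> P \<and> m * \<rho> \<le> r p \<and> dist x p \<le> (1 + b / 8) * \<rho>" for x \<rho> p
  define centre where
    "centre x \<rho> = (if \<exists>p. target x \<rho> p then SOME p. target x \<rho> p else x)" for x \<rho>
  define \<sigma> :: "'a alice_strategy" where
    "\<sigma> h = (centre (fst (last h)) (snd (last h)), b / 2)" for h
  have centre_eq: "centre x \<rho> = p" if "target x \<rho> p" "\<rho> > 0" for x \<rho> p
  proof -
    have "target x \<rho> (centre x \<rho>)" using that someI_ex[of "target x \<rho>"] by (auto simp: centre_def)
    moreover have "q = p" if q: "target x \<rho> q" for q
    proof (rule large_close_unique[where R = "4 * \<rho>"])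
      have "dist q p \<le> (1 + b / 8) * \<rho> + (1 + b / 8) * \<rho>"
        using q \<open>target x \<rho> p\<close> dist_triangle3[of q p x] unfolding target_def by linarith
      also have "\<dots> = (2 + b / 4) * \<rho>" by (simp add: algebra_simps)
      also have "\<dots> < 4 * \<rho>" using \<open>\<rho> > 0\<close> b by (intro mult_strict_right_mono) auto
      finally show "dist q p < 4 * \<rho>" .
      have "4 * \<rho> = \<kappa> * (m * \<rho>)" using \<kappa>_pos by (simp add: m_def)
      also have "\<dots> \<le> \<kappa> * r p'" if "target x \<rho> p'" for p'
        using that \<kappa>_pos by (intro mult_left_mono) (auto simp: target_def)
      finally show "4 * \<rho> \<le> \<kappa> * r q" "4 * \<rho> \<le> \<kappa> * r p" using q \<open>target x \<rho> p\<close> by blast+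
    qed (use q \<open>target x \<rho> p\<close> in \<open>auto simp: target_def\<close>)
    ultimately show ?thesis by blast
  qed
  have centre_close: "dist x (centre x \<rho>) \<le> (1 + b / 8) * \<rho>" if "\<rho> > 0" for x \<rho>
  proof (cases "\<exists>p. target x \<rho> p")
    case True
    then have "target x \<rho> (centre x \<rho>)" using someI_ex[of "target x \<rho>"] by (auto simp: centre_def)
    then show ?thesis by (simp add: target_def)
  next
    case False
    then show ?thesis using that b by (simp add: centre_def)
  qed
  have win: "(\<Inter>k. cball (x k) (\<rho> k)) \<inter> {x. \<exists>\<epsilon>>0. \<forall>p\<in>P. \<epsilon> * r p \<le> dist x p} \<noteq> {}"
    if play: "bob_play b UNIV \<sigma> x \<rho>" for x \<rho>
  proof -
    have \<rho>0: "\<rho> 0 > 0"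
      and sub: "\<And>k. cball (x (Suc k)) (\<rho> (Suc k)) \<subseteq> cball (x k) (\<rho> k) - cball (centre (x k) (\<rho> k)) (b / 2 * \<rho> k)"
      and rad: "\<And>k. b * \<rho> k \<le> \<rho> (Suc k)" "\<And>k. \<rho> (Suc k) \<le> \<rho> k"
      using play by (auto simp: bob_play_def blocked_ball_def \<sigma>_def)
    have pos: "\<rho> k > 0" for k
    proof (induction k)
      case (Suc k)
      then have "0 < b * \<rho> k" using b by simp
      also have "\<dots> \<le> \<rho> (Suc k)" by (rule rad)
      finally show ?case .
    qed (rule \<rho>0)
    have contract: "\<rho> (Suc k) \<le> (1 - 3 * b / 16) * \<rho> k" for k
    proof -
      have "\<rho> (Suc k) + b / 2 * \<rho> k < dist (x (Suc k)) (centre (x k) (\<rho> k))"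
        using sub[of k] pos[of k] pos[of "Suc k"] b by (intro dist_gt_of_disjoint_cballs) auto
      also have "\<dots> \<le> dist (x (Suc k)) (x k) + dist (x k) (centre (x k) (\<rho> k))"
        by (rule dist_triangle)
      also have "dist (x k) (centre (x k) (\<rho> k)) \<le> (1 + b / 8) * \<rho> k"
        by (rule centre_close[OF pos])
      also have "dist (x (Suc k)) (x k) \<le> \<rho> k - \<rho> (Suc k)"
      proof -
        have "cball (x (Suc k)) (\<rho> (Suc k)) \<subseteq> cball (x k) (\<rho> k)" using sub[of k] by blast
        then show ?thesis using pos[of "Suc k"] unfolding cball_subset_cball_iff by simp
      qed
      finally show ?thesis by (simp add: algebra_simps)
    qed
    have geometric: "\<rho> k \<le> (1 - 3 * b / 16) ^ k * \<rho> 0" for k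
    proof (induction k)
      case (Suc k)
      have "\<rho> (Suc k) \<le> (1 - 3 * b / 16) * \<rho> k" by (rule contract)
      also have "\<dots> \<le> (1 - 3 * b / 16) * ((1 - 3 * b / 16) ^ k * \<rho> 0)"
        using b Suc by (intro mult_left_mono) auto
      finally show ?case by (simp add: mult.assoc)
    qed simp
    have small: "\<exists>k. \<rho> k < e" if "e > 0" for e
    proof -
      have "\<exists>k. (1 - 3 * b / 16) ^ k < e / \<rho> 0"
        using b that \<rho>0 by (intro real_arch_pow_inv) auto
      then obtain k where "(1 - 3 * b / 16) ^ k < e / \<rho> 0" by blast
      then have "(1 - 3 * b / 16) ^ k * \<rho> 0 < e" by (simp only: pos_less_divide_eq[OF \<rho>0])
      then show ?thesis using geometric[of k] by (blast intro: le_less_trans)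
    qed
    have "(\<Inter>k. cball (x k) (\<rho> k)) \<noteq> {}"
    proof (rule compact_nest)
      show "cball (x n) (\<rho> n) \<subseteq> cball (x k) (\<rho> k)" if "k \<le> n" for k n
        by (rule lift_Suc_antimono_le[OF _ that]) (use sub in blast)
      show "cball (x k) (\<rho> k) \<noteq> {}" for k using pos[of k] by simp
    qed simp
    then obtain z where z: "\<And>k. z \<in> cball (x k) (\<rho> k)" by blast
    \<comment> \<open>Either \<open>p\<close> was the target at step \<open>k\<close> and got blocked, or it lies outside the enlarged ball.\<close>
    have key: "b / 8 * \<rho> k \<le> dist z p" if "p \<in> P" "m * \<rho> k \<le> r p" for p k
    proof (cases "target (x k) (\<rho> k) p")
      case True
      then have "centre (x k) (\<rho> k) = p" using centre_eq pos by blast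
      then have "z \<notin> cball p (b / 2 * \<rho> k)" using sub[of k] z[of "Suc k"] by auto
      then have "b / 2 * \<rho> k < dist z p" by (simp add: dist_commute)
      moreover have "b / 8 * \<rho> k \<le> b / 2 * \<rho> k" using pos[of k] b by (intro mult_right_mono) auto
      ultimately show ?thesis by linarith
    next
      case False
      then have "(1 + b / 8) * \<rho> k < dist (x k) p" using that by (auto simp: target_def)
      also have "\<dots> \<le> dist (x k) z + dist z p" by (rule dist_triangle)
      also have "dist (x k) z \<le> \<rho> k" using z by simp
      finally show ?thesis by (simp add: algebra_simps)
    qed
    \<comment> \<open>The first term serves the points that are large already at the start of the game, the second one those
        that become large later, when the radius has dropped by a factor of at most \<open>1 / b\<close> in one step.\<close>
    define \<epsilon> where "\<epsilon> = min (b / 8 * \<rho> 0 / max B 1) (b\<^sup>2 / (8 * m))"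
    have "\<epsilon> > 0" using b \<rho>0 m by (simp add: \<epsilon>_def max_def)
    moreover have "\<epsilon> * r p \<le> dist z p" if p: "p \<in> P" for p
    proof -
      obtain k0 where "\<rho> k0 < r p / m" using small r_pos[OF p] m by (metis divide_pos_pos)
      then have "m * \<rho> k0 \<le> r p" using m by (simp add: field_simps)
      then have ex: "\<exists>k. m * \<rho> k \<le> r p" by blast
      define k where "k = (LEAST k. m * \<rho> k \<le> r p)"
      have k: "m * \<rho> k \<le> r p" unfolding k_def using ex by (rule LeastI_ex)
      have "\<epsilon> * r p \<le> b / 8 * \<rho> k"
      proof (cases k)
        case 0
        have "\<epsilon> * r p \<le> (b / 8 * \<rho> 0 / max B 1) * max B 1"
          using r_le[OF p] r_pos[OF p] b \<rho>0 by (intro mult_mono) (auto simp: \<epsilon>_def)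
        also have "\<dots> = b / 8 * \<rho> 0" by (simp add: max_def)
        finally show ?thesis using 0 by simp
      next
        case (Suc j)
        then have "\<not> m * \<rho> j \<le> r p" using not_less_Least[of j "\<lambda>k. m * \<rho> k \<le> r p"] k_def by simp
        then have "b * r p \<le> m * (b * \<rho> j)" using b by (simp add: algebra_simps mult_left_mono)
        also have "\<dots> \<le> m * \<rho> k" using rad(1)[of j] m Suc by simp
        finally have *: "b * r p \<le> m * \<rho> k" .
        have "\<epsilon> * r p \<le> b\<^sup>2 / (8 * m) * r p"
          using r_pos[OF p] by (intro mult_right_mono) (auto simp: \<epsilon>_def)
        also have "\<dots> = b / (8 * m) * (b * r p)" by (simp add: power2_eq_square)
        also have "\<dots> \<le> b / (8 * m) * (m * \<rho> k)" using * b m by (intro mult_left_mono) auto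
        also have "\<dots> = b / 8 * \<rho> k" using m by simp
        finally show ?thesis .
      qed
      also have "\<dots> \<le> dist z p" by (rule key[OF p k])
      finally show ?thesis .
    qed
    ultimately show ?thesis using z by blast
  qed
  have "legal_strategy b \<sigma>" using b by (simp add: legal_strategy_def \<sigma>_def)
  with win show ?thesis unfolding beta_absolute_winning_def by blast
qed

section \<open>The dimension of the points that avoid a separated family\<close>

text \<open>
  The cubes are images under \<open>\<phi>\<close> of the cubes of the unit cube, so that full-dimensional cubes and arcs of
  circles are treated alike.  The number \<open>n + 2\<close> is the diameter \<open>n\<close> of a cube, in units of the scale, plus
  a margin of one unit on either side.  The hypothesis \<open>start\<close> bounds the size of the points that are
  dangerous at all, so that the balls avoided at level 0 are large enough for them.
\<close>
theorem separated_family_dimension: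
  fixes P :: "'a::metric_space set" and \<phi> :: "'b::euclidean_space \<Rightarrow> 'a"
  assumes "separated_family P r \<kappa> B"
    and R: "R \<ge> 2" and \<rho>: "\<rho> > 0" and \<mu>: "\<mu> > 0" and \<epsilon>: "\<epsilon> > 0"
    and lower: "\<And>s t. s \<in> cbox 0 One \<Longrightarrow> t \<in> cbox 0 One \<Longrightarrow> \<mu> * \<rho> * norm (s - t) \<le> dist (\<phi> s) (\<phi> t)"
    and upper: "\<And>s t. s \<in> cbox 0 One \<Longrightarrow> t \<in> cbox 0 One \<Longrightarrow> dist (\<phi> s) (\<phi> t) \<le> \<rho> * norm (s - t)"
    and big: "overlap_bound \<mu> DIM('b) + 2 \<le> R ^ DIM('b)"
    and R\<epsilon>: "\<epsilon> * real (DIM('b) + 2) * (real R)\<^sup>2 \<le> \<kappa>"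
    and start: "\<And>p s. p \<in> P \<Longrightarrow> s \<in> cbox 0 One \<Longrightarrow> dist (\<phi> s) p < \<epsilon> * r p \<Longrightarrow>
        \<kappa> * r p \<le> real (DIM('b) + 2) * \<rho> * real R"
  shows "ereal (ln (real (R ^ DIM('b) - overlap_bound \<mu> DIM('b))) / ln (real R))
    \<le> hausdorff_dim {x \<in> \<phi> ` cbox 0 One. \<forall>p\<in>P. \<epsilon> * r p \<le> dist x p}"
proof -
  interpret separated_family P r \<kappa> B by fact
  let ?n = "real (DIM('b) + 2)"
  have R0: "R > 0" using R by simp
  \<comment> \<open>\<open>p\<close> is a threat to a cube when it is large for its level and its ball of the next scale reaches the cube.\<close>
  define threat where "threat k v p \<longleftrightarrow> p \<in> P \<and> ?n * \<rho> / real R ^ k \<le> \<kappa> * r p \<and>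
    (\<exists>s\<in>grid_cube R k v. dist (\<phi> s) p < \<rho> / real R ^ Suc k)" for k v p
  have threat_unique: "p = q" if v: "v \<in> grid_nodes R k" and pq: "threat k v p" "threat k v q" for k v p q
  proof -
    obtain s t where st: "s \<in> grid_cube R k v" "dist (\<phi> s) p < \<rho> / real R ^ Suc k"
        "t \<in> grid_cube R k v" "dist (\<phi> t) q < \<rho> / real R ^ Suc k"
      using pq by (auto simp: threat_def)
    have "dist (\<phi> s) (\<phi> t) \<le> \<rho> * norm (s - t)"
      using st grid_cube_subset_unit[OF v R0] by (intro upper) blast+
    also have "\<dots> \<le> \<rho> * (real DIM('b) / real R ^ k)"
      using \<rho> norm_diff_grid_cube[OF st(1,3)] by (intro mult_left_mono) auto
    finally have 1: "dist (\<phi> s) (\<phi> t) \<le> real DIM('b) * \<rho> / real R ^ k" by (simp add: mult.commute)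
    have "\<rho> / real R ^ Suc k \<le> \<rho> / real R ^ k"
      using R \<rho> by (intro divide_left_mono power_increasing) auto
    then have "dist (\<phi> s) p < \<rho> / real R ^ k" "dist (\<phi> t) q < \<rho> / real R ^ k" using st by auto
    moreover have "dist p q \<le> dist (\<phi> s) p + dist (\<phi> s) (\<phi> t) + dist (\<phi> t) q"
      using dist_triangle3[of p q "\<phi> s"] dist_triangle[of "\<phi> s" q "\<phi> t"] by linarith
    moreover have "?n * \<rho> / real R ^ k = real DIM('b) * \<rho> / real R ^ k + \<rho> / real R ^ k + \<rho> / real R ^ k"
      by (simp add: add_divide_distrib[symmetric] algebra_simps)
    ultimately have "dist p q < ?n * \<rho> / real R ^ k" using 1 by linarith
    then show "p = q" using pq by (intro large_close_unique) (auto simp: threat_def)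
  qed
  show ?thesis
  proof (rule pruned_grid_dimension[OF R \<rho> \<mu> lower big, where p = "\<lambda>k v. SOME p. threat k v p"])
    fix v s
    assume v: "\<And>k. v k \<in> grid_nodes R k" and s: "\<And>k. s \<in> grid_cube R k (v k)"
      and avoid: "\<And>k. \<rho> / real R ^ Suc k \<le> dist (SOME p. threat k (v k) p) (\<phi> s)"
    have s1: "s \<in> cbox 0 One" using grid_cube_subset_unit[OF v R0] s by blast
    have "\<epsilon> * r q \<le> dist (\<phi> s) q" if q: "q \<in> P" for q
    proof (rule ccontr)
      assume "\<not> ?thesis"
      then have near: "dist (\<phi> s) q < \<epsilon> * r q" by simp
      have "\<exists>k. ?n * \<rho> / (\<kappa> * r q) < real R ^ k" using R by (intro real_arch_pow) simp
      then obtain k0 where "?n * \<rho> / (\<kappa> * r q) < real R ^ k0" by blast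
      then have "?n * \<rho> / real R ^ k0 \<le> \<kappa> * r q"
        using \<kappa>_pos r_pos[OF q] R0 by (simp add: pos_divide_less_eq pos_divide_le_eq mult.commute)
      then have ex: "\<exists>k. ?n * \<rho> / real R ^ k \<le> \<kappa> * r q" by blast
      \<comment> \<open>The first level at which \<open>q\<close> counts as large; there its size exceeds the threshold at most by the factor \<open>R\<close>,
          so the ball of radius \<open>\<epsilon> r(q)\<close> is contained in the one that has been avoided.\<close>
      define k where "k = (LEAST k. ?n * \<rho> / real R ^ k \<le> \<kappa> * r q)"
      have k: "?n * \<rho> / real R ^ k \<le> \<kappa> * r q" unfolding k_def using ex by (rule LeastI_ex)
      have "\<kappa> * r q \<le> ?n * \<rho> * real R / real R ^ k"
      proof (cases k)
        case 0
        then show ?thesis using start[OF q s1 near] by simp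
      next
        case (Suc j)
        then have "\<not> ?n * \<rho> / real R ^ j \<le> \<kappa> * r q"
          using not_less_Least[of j "\<lambda>k. ?n * \<rho> / real R ^ k \<le> \<kappa> * r q"] k_def by simp
        then show ?thesis using Suc R0 by simp
      qed
      then have "\<epsilon> * (\<kappa> * r q) \<le> \<epsilon> * (?n * \<rho> * real R / real R ^ k)"
        using \<epsilon> by (intro mult_left_mono) auto
      also have "\<dots> = (\<epsilon> * ?n * (real R)\<^sup>2) * (\<rho> / real R ^ Suc k)"
        using R0 by (simp add: power2_eq_square)
      also have "\<dots> \<le> \<kappa> * (\<rho> / real R ^ Suc k)"
        using R\<epsilon> \<rho> by (intro mult_right_mono) auto
      finally have "\<kappa> * (\<epsilon> * r q) \<le> \<kappa> * (\<rho> / real R ^ Suc k)"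
        by (simp only: mult.left_commute)
      then have "\<epsilon> * r q \<le> \<rho> / real R ^ Suc k"
        using \<kappa>_pos by (simp only: mult_le_cancel_left_pos)
      with near have n: "dist (\<phi> s) q < \<rho> / real R ^ Suc k" by linarith
      then have "threat k (v k) q" using q k s by (auto simp: threat_def)
      then have "(SOME p. threat k (v k) p) = q" using threat_unique[OF v] by blast
      with avoid[of k] n show False by (simp add: dist_commute)
    qed
    with s1 show "\<phi> s \<in> {x \<in> \<phi> ` cbox 0 One. \<forall>p\<in>P. \<epsilon> * r p \<le> dist x p}" by blast
  qed
qed

section \<open>The defect of the dimension as a function of \<open>t\<close>\<close>
lemma le_expI: "x > 0 \<Longrightarrow> ln x \<le> c \<Longrightarrow> x \<le> exp c" for x c :: real
  using exp_le_cancel_iff[of "ln x" c] by simp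

lemma le_divide_of_defect:
  fixes a u y z L :: real
  assumes "0 < L" "a * L - u \<le> y" "u \<le> L * z"
  shows "a - z \<le> y / L"
proof -
  have "(a - z) * L \<le> y" using assms(2,3) by (simp add: algebra_simps)
  then show ?thesis using assms(1) by (simp add: pos_le_divide_eq)
qed

text \<open>
  The ratio \<open>R\<close> is the integer part of \<open>(e\<^sup>t / M)\<^bsup>1/2\<^esup>\<close>, the largest one allowed by \<open>M R\<^sup>2 \<le> e\<^sup>t\<close>.  Then
  \<open>ln (R\<^sup>n - C) = n ln R + ln (1 - C / R\<^sup>n)\<close>, where the last term is at least \<open>- 2 C / R\<^sup>n\<close>, and for large \<open>t\<close> both
  \<open>R \<ge> (e\<^sup>t / M)\<^bsup>1/2\<^esup> / 2\<close> and \<open>ln R \<ge> t / 4\<close> hold, which determines \<open>k0\<close>.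
\<close>
lemma dimension_asymptotics:
  fixes n C :: nat and M :: real
  assumes n: "n \<ge> 1" and M: "M > 0"
  obtains t1 k0 :: real where "t1 > 0" "k0 > 0"
    "\<And>t. t \<ge> t1 \<Longrightarrow> \<exists>R::nat. R \<ge> 2 \<and> C + 2 \<le> R ^ n \<and> M * (real R)\<^sup>2 \<le> exp t \<and>
       real n - k0 / (t * exp (real n * t / 2)) \<le> ln (real (R ^ n - C)) / ln (real R)"
proof
  define t1 where "t1 = max 1 (max (2 * ln ((2 * real C + 4) * sqrt M)) (4 * ln (2 * sqrt M)))"
  define k0 where "k0 = 8 * real C * (2 * sqrt M) ^ n + 1"
  show "t1 > 0" by (simp add: t1_def)
  show k0: "k0 > 0" using M by (simp add: k0_def add_nonneg_pos)
  fix t assume "t \<ge> t1"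
  then have t: "t \<ge> 1" "ln ((2 * real C + 4) * sqrt M) \<le> t / 2" "ln (2 * sqrt M) \<le> t / 4"
    by (auto simp: t1_def)
  have sM: "sqrt M > 0" using M by simp
  define y where "y = exp (t / 2) / sqrt M"
  define R where "R = nat \<lfloor>y\<rfloor>"
  have y: "y \<ge> 2 * real C + 4"
  proof -
    have "(2 * real C + 4) * sqrt M \<le> exp (t / 2)" using t(2) sM by (intro le_expI) (auto simp: add_nonneg_pos)
    then show ?thesis using sM by (simp add: y_def field_simps)
  qed
  have Ry: "real R \<le> y" "y - 1 < real R" using y by (auto simp: R_def; linarith)+
  have R2: "R \<ge> 2" "real R \<ge> 2 * real C + 2" "real R \<ge> y / 2" using y Ry by auto
  have Rn: "real R ^ n \<ge> real R" using R2(1) n by (intro self_le_power) auto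
  have "exp (t / 4) \<le> real R"
  proof -
    have "2 * sqrt M \<le> exp (t / 4)" using t(3) sM by (intro le_expI) auto
    then have "exp (t / 4) * (2 * sqrt M) \<le> exp (t / 4) * exp (t / 4)" by (intro mult_left_mono) auto
    also have "\<dots> = exp (t / 2)" by (simp add: exp_add[symmetric])
    finally have "exp (t / 4) \<le> y / 2" using sM by (simp add: y_def field_simps)
    with R2(3) show ?thesis by simp
  qed
  then have lnR: "t / 4 \<le> ln (real R)" using R2(1) by (subst ln_ge_iff) auto
  have lnR0: "ln (real R) > 0" using R2 by simp
  have RnC: "real C / real R ^ n \<le> 1 / 2" "C \<le> R ^ n" "C + 2 \<le> R ^ n"
  proof -
    have a: "2 * real C + 2 \<le> real R ^ n" using Rn R2 by linarith
    then have "0 < real R ^ n" by linarith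
    with a show "real C / real R ^ n \<le> 1 / 2" by (simp add: field_simps)
    have "real (2 * C + 2) \<le> real (R ^ n)" using a by simp
    then have "2 * C + 2 \<le> R ^ n" unfolding of_nat_le_iff .
    then show "C \<le> R ^ n" "C + 2 \<le> R ^ n" by auto
  qed
  show "\<exists>R::nat. R \<ge> 2 \<and> C + 2 \<le> R ^ n \<and> M * (real R)\<^sup>2 \<le> exp t \<and>
       real n - k0 / (t * exp (real n * t / 2)) \<le> ln (real (R ^ n - C)) / ln (real R)"
  proof (intro exI[of _ R] conjI)
    have "M * (real R)\<^sup>2 \<le> M * y\<^sup>2" using Ry M by (intro mult_left_mono power_mono) auto
    also have "\<dots> = (exp (t / 2))\<^sup>2" using M by (simp add: y_def power_divide)
    also have "\<dots> = exp t" by (simp add: power2_eq_square exp_add[symmetric])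
    finally show "M * (real R)\<^sup>2 \<le> exp t" .
    let ?x = "real C / real R ^ n"
    have "ln (real (R ^ n - C)) = ln (real R ^ n * (1 - ?x))"
      using RnC R2 by (simp add: of_nat_diff algebra_simps)
    also have "\<dots> = real n * ln (real R) + ln (1 - ?x)"
      using RnC(1) R2 by (subst ln_mult) (auto simp: ln_realpow)
    finally have "ln (real (R ^ n - C)) = real n * ln (real R) + ln (1 - ?x)" .
    moreover have "ln (1 - ?x) \<ge> - ?x - 2 * ?x\<^sup>2"
      using RnC(1) by (intro ln_one_minus_pos_lower_bound) auto
    moreover have "- ?x - 2 * ?x\<^sup>2 \<ge> - 2 * ?x"
    proof -
      have "2 * ?x \<le> 1" using RnC(1) by linarith
      then have "?x * (2 * ?x) \<le> ?x * 1" by (rule mult_left_mono) simp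
      then show ?thesis by (simp add: power2_eq_square)
    qed
    ultimately have A: "real n * ln (real R) - 2 * ?x \<le> ln (real (R ^ n - C))" by linarith
    have "2 * ?x \<le> ln (real R) * (k0 / (t * exp (real n * t / 2)))"
    proof -
      have "(exp (t / 2) / (2 * sqrt M)) ^ n \<le> real R ^ n"
        using R2(3) sM by (intro power_mono) (auto simp: y_def)
      moreover have "exp (t / 2) ^ n = exp (real n * t / 2)" by (simp add: exp_of_nat_mult[symmetric])
      ultimately have e: "exp (real n * t / 2) \<le> real R ^ n * (2 * sqrt M) ^ n"
        using sM by (simp add: power_divide field_simps)
      have "2 * ?x * (t * exp (real n * t / 2)) \<le> 2 * ?x * (t * (real R ^ n * (2 * sqrt M) ^ n))"
        using e t by (intro mult_left_mono) auto
      also have "\<dots> = 2 * real C * (2 * sqrt M) ^ n * t" using R2 by simp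
      also have "\<dots> \<le> k0 * (t / 4)" using t by (simp add: k0_def algebra_simps)
      also have "\<dots> \<le> k0 * ln (real R)" using lnR k0 by (intro mult_left_mono) auto
      finally have *: "2 * ?x * (t * exp (real n * t / 2)) \<le> k0 * ln (real R)" .
      have "t * exp (real n * t / 2) > 0" using t by simp
      with * have "2 * ?x \<le> k0 * ln (real R) / (t * exp (real n * t / 2))"
        by (simp only: pos_le_divide_eq)
      also have "\<dots> = ln (real R) * (k0 / (t * exp (real n * t / 2)))" by simp
      finally show ?thesis .
    qed
    with lnR0 A show "real n - k0 / (t * exp (real n * t / 2)) \<le> ln (real (R ^ n - C)) / ln (real R)"
      by (rule le_divide_of_defect)
  qed (rule R2(1), rule RnC(3))
qed


section \<open>Orbits of quadratic irrationals are separated\<close>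

text \<open>
  The left-hand side is the resultant of the forms \<open>a X\<^sup>2 + b X + c\<close> and \<open>a' X\<^sup>2 + b' X + c'\<close>, with roots
  \<open>x, y\<close> and \<open>x', y'\<close>.
\<close>
lemma resultant_of_roots:
  fixes a a' x y x' y' :: "'a::comm_ring_1"
  assumes "b = - a * (x + y)" "c = a * x * y" "b' = - a' * (x' + y')" "c' = a' * x' * y'"
  shows "(a * c' - a' * c)\<^sup>2 - (a * b' - a' * b) * (b * c' - b' * c)
     = a\<^sup>2 * a'\<^sup>2 * ((x - x') * (x - y') * (y - x') * (y - y'))"
  unfolding assms by (simp add: power2_eq_square algebra_simps)

text \<open>
  Here \<open>\<delta>\<close> is the distance between roots \<open>\<beta>\<close> and \<open>\<beta>'\<close> of two forms, \<open>r\<close> and \<open>r'\<close> are their distances from their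
  conjugates, and \<open>u\<close>, \<open>v\<close>, \<open>w\<close> are the other three differences of roots.  If \<open>\<delta>\<close> is smaller than \<open>r\<close> and \<open>r'\<close>,
  then \<open>u \<le> 2 r'\<close>, \<open>v \<le> 2 r\<close> and \<open>w \<le> 3 max r r'\<close>, and the product bound leaves \<open>min r r' \<le> 12 S \<delta>\<close>.
\<close>
lemma separation_from_resultant:
  fixes r r' \<delta> u v w S :: real
  assumes r: "r > 0" "r' > 0" and S: "S > 0" and \<delta>: "\<delta> \<ge> 0"
    and u: "0 \<le> u" "u \<le> \<delta> + r'" and v: "0 \<le> v" "v \<le> \<delta> + r" and w: "0 \<le> w" "w \<le> r + \<delta> + r'"
    and prod: "(r * r')\<^sup>2 \<le> S * (\<delta> * u * v * w)"
  shows "min 1 (1 / (12 * S)) * min r r' \<le> \<delta>"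
proof (cases "min r r' \<le> \<delta>")
  case True
  have "min 1 (1 / (12 * S)) * min r r' \<le> 1 * min r r'"
    using r by (intro mult_right_mono) auto
  with True show ?thesis by linarith
next
  case False
  define M where "M = max r r'"
  have M: "M > 0" using r by (simp add: M_def)
  have "u * v * w \<le> (2 * r') * (2 * r) * (3 * M)"
    using False u v w r M by (intro mult_mono) (auto simp: M_def)
  then have "S * \<delta> * (u * v * w) \<le> S * \<delta> * ((2 * r') * (2 * r) * (3 * M))"
    using S \<delta> by (intro mult_left_mono) auto
  with prod have "(r * r') * (r * r') \<le> (r * r') * (12 * S * \<delta> * M)"
    by (simp add: power2_eq_square algebra_simps)
  then have "r * r' \<le> 12 * S * \<delta> * M" using r by (simp only: mult_le_cancel_left_pos mult_pos_pos)
  moreover have "r * r' = min r r' * M" by (auto simp: M_def min_def max_def)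
  ultimately have "min r r' \<le> 12 * S * \<delta>" using M by simp
  then have "1 / (12 * S) * min r r' \<le> \<delta>" using S by (simp add: field_simps)
  moreover have "min 1 (1 / (12 * S)) * min r r' \<le> 1 / (12 * S) * min r r'"
    using r by (intro mult_right_mono) auto
  ultimately show ?thesis by linarith
qed

text \<open>
  In the two cases of interest \<open>L\<close> is \<open>\<int>\<close> or \<open>\<int>[\<i> \<surd>d]\<close>.  The latter has index 1 or 2 in the ring of integers
  of the field, depending on \<open>d\<close> modulo 4, which is why integers are multiplied by 2.
\<close>
locale discrete_order =
  fixes K L :: "'a::real_normed_field set"
  assumes K_1: "1 \<in> K"
    and K_diff: "x \<in> K \<Longrightarrow> y \<in> K \<Longrightarrow> x - y \<in> K"
    and K_divide: "x \<in> K \<Longrightarrow> y \<in> K \<Longrightarrow> x / y \<in> K"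
    and L_1: "1 \<in> L"
    and L_diff: "x \<in> L \<Longrightarrow> y \<in> L \<Longrightarrow> x - y \<in> L"
    and L_mult: "x \<in> L \<Longrightarrow> y \<in> L \<Longrightarrow> x * y \<in> L"
    and L_subset_K: "L \<subseteq> K"
    and L_norm: "x \<in> L \<Longrightarrow> x \<noteq> 0 \<Longrightarrow> 1 \<le> norm x"
    and L_integers: "x \<in> ring_of_integers K \<Longrightarrow> 2 * x \<in> L"
    and L_denominator: "x \<in> K \<Longrightarrow> \<exists>n\<in>L. n \<noteq> 0 \<and> n * x \<in> L"
begin

lemma K_0: "0 \<in> K" using K_diff[OF K_1 K_1] by simp
lemma K_minus: "x \<in> K \<Longrightarrow> - x \<in> K" using K_diff[OF K_0] by force
lemma K_add: "x \<in> K \<Longrightarrow> y \<in> K \<Longrightarrow> x + y \<in> K" using K_diff[OF _ K_minus] by force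
lemma K_mult: "x \<in> K \<Longrightarrow> y \<in> K \<Longrightarrow> x * y \<in> K"
  using K_divide[of x "1 / y"] K_divide[OF K_1, of y] by simp
lemma L_0: "0 \<in> L" using L_diff[OF L_1 L_1] by simp
lemma L_minus: "x \<in> L \<Longrightarrow> - x \<in> L" using L_diff[OF L_0] by force
lemma L_add: "x \<in> L \<Longrightarrow> y \<in> L \<Longrightarrow> x + y \<in> L" using L_diff[OF _ L_minus] by force
lemma L_2: "2 \<in> L" using L_add[OF L_1 L_1] by simp

lemmas L_closed = L_0 L_1 L_2 L_diff L_mult L_minus L_add
lemmas K_closed = K_0 K_1 K_diff K_divide K_minus K_add K_mult

definition is_form :: "'a \<Rightarrow> 'a \<Rightarrow> 'a \<Rightarrow> 'a \<Rightarrow> bool" where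
  "is_form \<beta> a b c \<longleftrightarrow> a \<in> L \<and> b \<in> L \<and> c \<in> L \<and> a \<noteq> 0 \<and> a * \<beta>\<^sup>2 + b * \<beta> + c = 0"

lemma galois_conj_form:
  assumes "\<beta> \<notin> K" "is_form \<beta> a b c"
  shows "galois_conj K \<beta> = - b / a - \<beta>"
proof -
  have "galois_conj K \<beta> = - (b / a) - \<beta>"
  proof (rule galois_conj_eq[OF K_1 K_diff K_divide assms(1)])
    show "b / a \<in> K" "c / a \<in> K" using assms(2) L_subset_K by (auto simp: is_form_def intro!: K_divide)
    have "a * (\<beta>\<^sup>2 + b / a * \<beta> + c / a) = a * \<beta>\<^sup>2 + b * \<beta> + c"
      using assms(2) by (simp add: is_form_def algebra_simps)
    then show "\<beta>\<^sup>2 + b / a * \<beta> + c / a = 0" using assms(2) by (simp add: is_form_def)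
  qed
  then show ?thesis by simp
qed

lemma form_coefficients:
  assumes "is_form \<beta> a b c" "\<gamma> = - b / a - \<beta>"
  shows "b = - a * (\<beta> + \<gamma>)" "c = a * \<beta> * \<gamma>" "(a * (\<beta> - \<gamma>))\<^sup>2 = b\<^sup>2 - 4 * a * c" "is_form \<gamma> a b c"
proof -
  have a: "a \<noteq> 0" and root: "a * \<beta>\<^sup>2 + b * \<beta> + c = 0" using assms(1) by (auto simp: is_form_def)
  show b: "b = - a * (\<beta> + \<gamma>)" using assms(2) a by simp
  have "c = - (a * \<beta>\<^sup>2 + b * \<beta>)" using root by (simp only: add_eq_0_iff)
  also have "\<dots> = a * \<beta> * \<gamma>" unfolding b by (simp add: algebra_simps power2_eq_square)
  finally show c: "c = a * \<beta> * \<gamma>" .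
  show "(a * (\<beta> - \<gamma>))\<^sup>2 = b\<^sup>2 - 4 * a * c" unfolding b c by (simp add: algebra_simps power2_eq_square)
  have "a * \<gamma>\<^sup>2 + b * \<gamma> + c = 0" unfolding b c by (simp add: algebra_simps power2_eq_square)
  then show "is_form \<gamma> a b c" using assms(1) by (simp add: is_form_def)
qed

lemma conj_notin_K:
  assumes "\<beta> \<notin> K" "is_form \<beta> a b c"
  shows "- b / a - \<beta> \<notin> K"
proof
  assume "- b / a - \<beta> \<in> K"
  moreover have "- b / a \<in> K" using assms(2) L_subset_K by (auto simp: is_form_def intro!: K_closed)
  ultimately have "- b / a - (- b / a - \<beta>) \<in> K" by (rule K_diff[of "- b / a", rotated])
  moreover have "- b / a - (- b / a - \<beta>) = \<beta>" by (simp add: algebra_simps)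
  ultimately show False using assms(1) by metis
qed

lemma quad_irrational_form:
  assumes "\<beta> \<in> quad_irrationals K"
  obtains a b c where "\<beta> \<notin> K" "is_form \<beta> a b c"
proof -
  obtain a b c where abc: "\<beta> \<notin> K" "a \<in> K" "b \<in> K" "c \<in> K" "a \<noteq> 0" "a * \<beta>\<^sup>2 + b * \<beta> + c = 0"
    using assms by (auto simp: quad_irrationals_def)
  obtain l m n where lmn: "l \<in> L" "l \<noteq> 0" "l * a \<in> L" "m \<in> L" "m \<noteq> 0" "m * b \<in> L" "n \<in> L" "n \<noteq> 0" "n * c \<in> L"
    using L_denominator abc by metis
  have "is_form \<beta> (m * n * (l * a)) (l * n * (m * b)) (l * m * (n * c))"
    unfolding is_form_def
  proof (intro conjI)
    have "m * n * (l * a) * \<beta>\<^sup>2 + l * n * (m * b) * \<beta> + l * m * (n * c)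
       = l * m * n * (a * \<beta>\<^sup>2 + b * \<beta> + c)" by (simp add: algebra_simps)
    then show "m * n * (l * a) * \<beta>\<^sup>2 + l * n * (m * b) * \<beta> + l * m * (n * c) = 0" using abc by simp
  qed (use lmn abc in \<open>auto intro!: L_mult\<close>)
  with abc(1) that show thesis by blast
qed

lemma discriminant_nonzero:
  assumes "\<beta> \<notin> K" "is_form \<beta> a b c"
  shows "b\<^sup>2 - 4 * a * c \<noteq> 0"
proof
  assume "b\<^sup>2 - 4 * a * c = 0"
  then have "(a * (\<beta> - (- b / a - \<beta>)))\<^sup>2 = 0" using form_coefficients(3)[OF assms(2) refl] by simp
  then have "\<beta> - (- b / a - \<beta>) = 0" using assms(2) unfolding is_form_def zero_eq_power2 mult_eq_0_iff by blast
  then have "\<beta> = - b / a - \<beta>" by (simp only: right_minus_eq)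
  then have "\<beta> + \<beta> = - b / a" by (simp only: eq_diff_eq)
  moreover have "\<beta> = (\<beta> + \<beta>) / 2" by simp
  ultimately have "\<beta> = (- b / a) / 2" by metis
  moreover have "(- b / a) / 2 \<in> K" using assms(2) L_subset_K L_2 by (auto simp: is_form_def intro!: K_closed)
  ultimately show False using assms(1) by simp
qed

text \<open>
  Substituting the inverse matrix into a form for \<open>\<beta>\<^sub>0\<close> gives a form for the image point with the same
  discriminant.  Since only twice the matrix entries lie in \<open>L\<close>, the form is multiplied by 4, hence the
  discriminant by 16.
\<close>
lemma orbit_form:
  assumes \<beta>0: "\<beta>0 \<notin> K" "is_form \<beta>0 A B C" and "\<beta> \<in> psl_orbit K \<beta>0"
  shows "\<beta> \<notin> K \<and> (\<exists>a b c. is_form \<beta> a b c \<and> b\<^sup>2 - 4 * a * c = 16 * (B\<^sup>2 - 4 * A * C))"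
proof -
  obtain a b c d z where z: "z \<in> {\<beta>0, galois_conj K \<beta>0}" and \<beta>: "\<beta> = (a * z + b) / (c * z + d)"
    and int: "a \<in> ring_of_integers K" "b \<in> ring_of_integers K" "c \<in> ring_of_integers K" "d \<in> ring_of_integers K"
    and det: "a * d - b * c = 1"
    using assms(3) unfolding psl_orbit_def by blast
  have abcd: "a \<in> K" "b \<in> K" "c \<in> K" "d \<in> K" using int by (auto simp: ring_of_integers_def)
  have zK: "z \<notin> K" and zf: "is_form z A B C"
    using z \<beta>0 conj_notin_K[OF \<beta>0] form_coefficients(4)[OF \<beta>0(2) refl] galois_conj_form[OF \<beta>0] by auto
  have w: "c * z + d \<noteq> 0"
  proof
    assume 0: "c * z + d = 0"
    show False
    proof (cases "c = 0")
      case True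
      then show False using 0 det by simp
    next
      case False
      then have "z = - d / c" using 0 by (simp add: field_simps eq_neg_iff_add_eq_0)
      moreover have "- d / c \<in> K" using abcd by (intro K_divide K_minus)
      ultimately show False using zK by metis
    qed
  qed
  have e1: "d * \<beta> - b = z / (c * z + d)"
  proof -
    have "d * \<beta> - b = (a * d - b * c) * z / (c * z + d)"
      using w by (simp add: \<beta> field_simps)
    then show ?thesis using det by simp
  qed
  have e2: "a - c * \<beta> = 1 / (c * z + d)"
  proof -
    have "a - c * \<beta> = (a * d - b * c) / (c * z + d)"
      using w by (simp add: \<beta> field_simps)
    then show ?thesis using det by simp
  qed
  have \<beta>K: "\<beta> \<notin> K"
  proof
    assume "\<beta> \<in> K"
    then have "(d * \<beta> - b) / (a - c * \<beta>) \<in> K" using abcd by (intro K_closed)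
    then show False using zK w by (simp add: e1 e2)
  qed
  define a2 b2 c2 d2 where "a2 = 2 * a" and "b2 = 2 * b" and "c2 = 2 * c" and "d2 = 2 * d"
  then have "a2 \<in> L" "b2 \<in> L" "c2 \<in> L" "d2 \<in> L" using int L_integers by auto
  define a' where "a' = A * d2 * d2 - B * d2 * c2 + C * c2 * c2"
  define b' where "b' = - (2 * A * b2 * d2) + B * (a2 * d2 + b2 * c2) - 2 * C * a2 * c2"
  define c' where "c' = A * b2 * b2 - B * a2 * b2 + C * a2 * a2"
  have L': "a' \<in> L" "b' \<in> L" "c' \<in> L"
    using zf \<open>a2 \<in> L\<close> \<open>b2 \<in> L\<close> \<open>c2 \<in> L\<close> \<open>d2 \<in> L\<close> L_2
    unfolding a'_def b'_def c'_def is_form_def by (auto intro!: L_add L_diff L_mult L_minus)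
  note defs = a'_def b'_def c'_def a2_def b2_def c2_def d2_def
  have "a' * \<beta>\<^sup>2 + b' * \<beta> + c' =
      4 * (A * (d * \<beta> - b)\<^sup>2 + B * (d * \<beta> - b) * (a - c * \<beta>) + C * (a - c * \<beta>)\<^sup>2)"
    unfolding defs by (simp add: algebra_simps power2_eq_square)
  also have "\<dots> = 4 * (A * z\<^sup>2 + B * z + C) / (c * z + d)\<^sup>2"
  proof -
    have "4 * (A * (z / w)\<^sup>2 + B * (z / w) * (1 / w) + C * (1 / w)\<^sup>2) = 4 * (A * z\<^sup>2 + B * z + C) / w\<^sup>2"
      if "w \<noteq> 0" for w using that by (simp add: field_simps power2_eq_square)
    then show ?thesis unfolding e1 e2 using w by blast
  qed
  also have "A * z\<^sup>2 + B * z + C = 0" using zf by (simp add: is_form_def)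
  finally have root: "a' * \<beta>\<^sup>2 + b' * \<beta> + c' = 0" by simp
  have "b'\<^sup>2 - 4 * a' * c' = (B\<^sup>2 - 4 * A * C) * (4 * (a * d - b * c))\<^sup>2"
    unfolding defs by (simp add: algebra_simps power2_eq_square)
  then have disc: "b'\<^sup>2 - 4 * a' * c' = 16 * (B\<^sup>2 - 4 * A * C)" using det by simp
  have "a' \<noteq> 0"
  proof
    assume a0: "a' = 0"
    then have b0: "b' \<noteq> 0" using disc discriminant_nonzero[OF zK zf] by auto
    have "\<beta> = - c' / b'" using root a0 b0 by (simp add: field_simps eq_neg_iff_add_eq_0)
    moreover have "- c' / b' \<in> K" using L' L_subset_K by (intro K_divide K_minus) auto
    ultimately show False using \<beta>K by metis
  qed
  then show ?thesis using \<beta>K L' root disc by (auto simp: is_form_def)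
qed

text \<open>
  Unless \<open>\<beta>'\<close> is the conjugate of \<open>\<beta>\<close>, where the claim is trivial, the two forms have no common root, so their resultant is a
  nonzero element of \<open>L\<close>.  Multiplying \<open>1 \<le> \<bar>Res\<bar>\<close> by the square of \<open>r(\<beta>) r(\<beta>')\<close> turns the leading
  coefficients into discriminants, because \<open>\<bar>a\<bar>\<^sup>2 r(\<beta>)\<^sup>2 = \<bar>\<Delta>\<bar>\<close>.
\<close>
lemma orbit_separated:
  assumes \<beta>: "\<beta> \<notin> K" "is_form \<beta> a b c" "b\<^sup>2 - 4 * a * c = \<Delta>"
    and \<beta>': "\<beta>' \<notin> K" "is_form \<beta>' a' b' c'" "b'\<^sup>2 - 4 * a' * c' = \<Delta>"
    and ne: "\<beta> \<noteq> \<beta>'"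
  shows "min 1 (1 / (12 * (norm \<Delta>)\<^sup>2)) * min (norm (\<beta> - galois_conj K \<beta>)) (norm (\<beta>' - galois_conj K \<beta>'))
    \<le> dist \<beta> \<beta>'"
proof -
  define \<gamma> where "\<gamma> = - b / a - \<beta>"
  define \<gamma>' where "\<gamma>' = - b' / a' - \<beta>'"
  have conj: "galois_conj K \<beta> = \<gamma>" "galois_conj K \<beta>' = \<gamma>'"
    using galois_conj_form \<beta> \<beta>' by (auto simp: \<gamma>_def \<gamma>'_def)
  note f = form_coefficients[OF \<beta>(2) \<gamma>_def] and f' = form_coefficients[OF \<beta>'(2) \<gamma>'_def]
  have \<Delta>: "\<Delta> \<noteq> 0" using discriminant_nonzero[OF \<beta>(1,2)] \<beta>(3) by simp
  have n: "(norm a * norm (\<beta> - \<gamma>))\<^sup>2 = norm \<Delta>" "(norm a' * norm (\<beta>' - \<gamma>'))\<^sup>2 = norm \<Delta>"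
    using f(3) f'(3) \<beta>(3) \<beta>'(3) by (simp_all flip: norm_mult norm_power)
  have r: "norm (\<beta> - \<gamma>) > 0" "norm (\<beta>' - \<gamma>') > 0" using n \<Delta> by (force, force)
  show ?thesis
  proof (cases "\<beta>' = \<gamma>")
    case True
    have "min 1 (1 / (12 * (norm \<Delta>)\<^sup>2)) * min (norm (\<beta> - \<gamma>)) (norm (\<beta>' - \<gamma>')) \<le> 1 * norm (\<beta> - \<gamma>)"
      by (intro mult_mono) auto
    then show ?thesis unfolding conj dist_norm using True by simp
  next
    case False
    have "\<beta> \<noteq> \<gamma>'"
    proof
      assume "\<beta> = \<gamma>'"
      then have "galois_conj K \<beta> = - b' / a' - \<gamma>'" using galois_conj_form[OF _ f'(4)] \<beta>(1) by simp
      then show False using False conj by (simp add: \<gamma>'_def)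
    qed
    moreover have "\<gamma> \<noteq> \<gamma>'"
    proof
      assume eq: "\<gamma> = \<gamma>'"
      have "galois_conj K \<gamma> = - b / a - \<gamma>" "galois_conj K \<gamma>' = - b' / a' - \<gamma>'"
        using galois_conj_form[OF _ f(4)] conj_notin_K[OF \<beta>(1,2)]
          galois_conj_form[OF _ f'(4)] conj_notin_K[OF \<beta>'(1,2)] by (auto simp: \<gamma>_def \<gamma>'_def)
      then show False using ne eq by (simp add: \<gamma>_def \<gamma>'_def)
    qed
    moreover have "a \<noteq> 0" "a' \<noteq> 0" using \<beta>(2) \<beta>'(2) by (auto simp: is_form_def)
    moreover note res = resultant_of_roots[OF f(1,2) f'(1,2)]
    ultimately have "(a * c' - a' * c)\<^sup>2 - (a * b' - a' * b) * (b * c' - b' * c) \<noteq> 0"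
      unfolding res using ne False by auto
    moreover have "(a * c' - a' * c)\<^sup>2 - (a * b' - a' * b) * (b * c' - b' * c) \<in> L"
      using \<beta>(2) \<beta>'(2) by (auto simp: is_form_def power2_eq_square intro!: L_closed)
    ultimately have "1 \<le> norm ((a * c' - a' * c)\<^sup>2 - (a * b' - a' * b) * (b * c' - b' * c))"
      by (intro L_norm)
    then have one: "1 \<le> (norm a)\<^sup>2 * (norm a')\<^sup>2 *
        (norm (\<beta> - \<beta>') * norm (\<beta> - \<gamma>') * norm (\<gamma> - \<beta>') * norm (\<gamma> - \<gamma>'))"
      unfolding res by (simp add: norm_mult norm_power)
    have "(norm (\<beta> - \<gamma>) * norm (\<beta>' - \<gamma>'))\<^sup>2 * 1 \<le> (norm (\<beta> - \<gamma>) * norm (\<beta>' - \<gamma>'))\<^sup>2 * ((norm a)\<^sup>2 * (norm a')\<^sup>2 *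
        (norm (\<beta> - \<beta>') * norm (\<beta> - \<gamma>') * norm (\<gamma> - \<beta>') * norm (\<gamma> - \<gamma>')))"
      by (intro mult_left_mono one) simp
    also have "\<dots> = (norm a * norm (\<beta> - \<gamma>))\<^sup>2 * (norm a' * norm (\<beta>' - \<gamma>'))\<^sup>2 *
        (norm (\<beta> - \<beta>') * norm (\<beta> - \<gamma>') * norm (\<gamma> - \<beta>') * norm (\<gamma> - \<gamma>'))"
      by (simp only: power_mult_distrib ac_simps)
    also have "\<dots> = (norm \<Delta>)\<^sup>2 * (dist \<beta> \<beta>' * norm (\<beta> - \<gamma>') * norm (\<gamma> - \<beta>') * norm (\<gamma> - \<gamma>'))"
      unfolding n by (simp add: power2_eq_square dist_norm)
    finally have prod: "(norm (\<beta> - \<gamma>) * norm (\<beta>' - \<gamma>'))\<^sup>2 \<le>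
        (norm \<Delta>)\<^sup>2 * (dist \<beta> \<beta>' * norm (\<beta> - \<gamma>') * norm (\<gamma> - \<beta>') * norm (\<gamma> - \<gamma>'))" by simp
    show ?thesis
      unfolding conj
    proof (rule separation_from_resultant[OF r _ _ _ _ _ _ _ _ prod])
      show "0 < (norm \<Delta>)\<^sup>2" using \<Delta> by simp
      show "norm (\<beta> - \<gamma>') \<le> dist \<beta> \<beta>' + norm (\<beta>' - \<gamma>')"
        using dist_triangle[of \<beta> \<gamma>' \<beta>'] by (simp add: dist_norm)
      show "norm (\<gamma> - \<beta>') \<le> dist \<beta> \<beta>' + norm (\<beta> - \<gamma>)"
        using dist_triangle[of \<gamma> \<beta>' \<beta>] by (simp add: dist_norm norm_minus_commute)
      show "norm (\<gamma> - \<gamma>') \<le> norm (\<beta> - \<gamma>) + dist \<beta> \<beta>' + norm (\<beta>' - \<gamma>')"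
        using dist_triangle[of \<gamma> \<gamma>' \<beta>] dist_triangle[of \<beta> \<gamma>' \<beta>'] by (simp add: dist_norm norm_minus_commute)
    qed auto
  qed
qed

theorem orbit_separated_family:
  assumes "\<beta>0 \<in> quad_irrationals K"
  shows "\<exists>\<kappa> B. \<kappa> \<le> 1 \<and> separated_family (psl_orbit K \<beta>0) (\<lambda>\<beta>. norm (\<beta> - galois_conj K \<beta>)) \<kappa> B"
proof -
  obtain A B C where f0: "\<beta>0 \<notin> K" "is_form \<beta>0 A B C" using quad_irrational_form[OF assms] by blast
  define \<Delta> where "\<Delta> = 16 * (B\<^sup>2 - 4 * A * C)"
  have \<Delta>: "\<Delta> \<noteq> 0" using discriminant_nonzero[OF f0] unfolding \<Delta>_def by (metis mult_eq_0_iff zero_neq_numeral)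
  have form: "\<exists>a b c. \<beta> \<notin> K \<and> is_form \<beta> a b c \<and> b\<^sup>2 - 4 * a * c = \<Delta>" if "\<beta> \<in> psl_orbit K \<beta>0" for \<beta>
    using orbit_form[OF f0 that] by (auto simp: \<Delta>_def)
  have size: "0 < norm (\<beta> - galois_conj K \<beta>) \<and> norm (\<beta> - galois_conj K \<beta>) \<le> sqrt (norm \<Delta>)"
    if \<beta>: "\<beta> \<in> psl_orbit K \<beta>0" for \<beta>
  proof -
    obtain a b c where f: "\<beta> \<notin> K" "is_form \<beta> a b c" "b\<^sup>2 - 4 * a * c = \<Delta>" using form[OF \<beta>] by blast
    let ?r = "norm (\<beta> - galois_conj K \<beta>)"
    have "(a * (\<beta> - galois_conj K \<beta>))\<^sup>2 = \<Delta>"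
      using form_coefficients(3)[OF f(2)] galois_conj_form[OF f(1,2)] f(3) by simp
    then have n: "(norm a * ?r)\<^sup>2 = norm \<Delta>" by (simp flip: norm_mult norm_power)
    have "1 \<le> norm a" using f(2) by (intro L_norm) (auto simp: is_form_def)
    then have "?r \<le> norm a * ?r" using mult_right_mono[of 1 "norm a" ?r] by simp
    also have "\<dots> = sqrt (norm \<Delta>)" using n by (intro real_sqrt_unique[symmetric]) auto
    finally show ?thesis using n \<Delta> by force
  qed
  have "separated_family (psl_orbit K \<beta>0) (\<lambda>\<beta>. norm (\<beta> - galois_conj K \<beta>))
      (min 1 (1 / (12 * (norm \<Delta>)\<^sup>2))) (sqrt (norm \<Delta>))"
  proof
    show "0 < min 1 (1 / (12 * (norm \<Delta>)\<^sup>2))" using \<Delta> by simp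
    show "min 1 (1 / (12 * (norm \<Delta>)\<^sup>2)) * min (norm (p - galois_conj K p)) (norm (q - galois_conj K q)) \<le> dist p q"
      if "p \<in> psl_orbit K \<beta>0" "q \<in> psl_orbit K \<beta>0" "p \<noteq> q" for p q
      using form[OF that(1)] form[OF that(2)] orbit_separated that(3) by metis
  qed (use size in auto)
  then show ?thesis by (intro exI[of _ "min 1 (1 / (12 * (norm \<Delta>)\<^sup>2))"] exI[of _ "sqrt (norm \<Delta>)"]) auto
qed

lemma base_in_orbit: "\<beta>0 \<in> psl_orbit K \<beta>0"
proof -
  have "0 \<in> ring_of_integers K" "1 \<in> ring_of_integers K"
    using K_0 K_1 int_imp_algebraic_int[of 1] by (auto simp: ring_of_integers_def)
  then have "(1 * \<beta>0 + 0) / (0 * \<beta>0 + 1) \<in> psl_orbit K \<beta>0"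
    unfolding psl_orbit_def by (intro CollectI exI[of _ 1] exI[of _ 0] exI[of _ \<beta>0] conjI refl) auto
  then show ?thesis by simp
qed

end


section \<open>Integers of the rational and the imaginary quadratic fields\<close>

lemma discrete_order_Rats: "discrete_order (\<rat> :: real set) \<int>"
proof
  show "1 \<le> norm x" if "x \<in> \<int>" "x \<noteq> 0" for x :: real
    using Ints_nonzero_abs_ge1[OF that] by simp
  show "2 * x \<in> \<int>" if "x \<in> ring_of_integers \<rat>" for x :: real
    using that by (auto simp: ring_of_integers_Rats)
  show "\<exists>n\<in>\<int>. n \<noteq> 0 \<and> n * x \<in> \<int>" if "x \<in> \<rat>" for x :: real
  proof -
    obtain a b where "b > 0" "x = of_int a / of_int b" using \<open>x \<in> \<rat>\<close> by (auto elim: Rats_cases')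
    then show ?thesis by (intro bexI[of _ "of_int b"]) auto
  qed
qed (auto simp: Ints_subset_Rats)

definition ipoly :: "int poly \<Rightarrow> 'a::comm_ring_1 \<Rightarrow> 'a" where
  "ipoly p x = poly (map_poly of_int p) x"

lemma ipoly_0 [simp]: "ipoly 0 x = 0"
  by (simp add: ipoly_def)

lemma ipoly_pCons [simp]: "ipoly (pCons a p) x = of_int a + x * ipoly p x"
  by (simp add: ipoly_def map_poly_pCons)

lemma ipoly_add: "ipoly (p + q) x = ipoly p x + ipoly q x"
proof -
  have "map_poly of_int (p + q) = map_poly of_int p + (map_poly of_int q :: 'a poly)"
    by (intro poly_eqI) (simp add: coeff_map_poly)
  then show ?thesis by (simp add: ipoly_def)
qed

lemma ipoly_smult: "ipoly (smult a p) x = of_int a * ipoly p x"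
  by (induction p) (simp_all add: algebra_simps)

lemma ipoly_mult: "ipoly (p * q) x = ipoly p x * ipoly q x"
  by (induction p) (simp_all add: ipoly_add ipoly_smult algebra_simps)

text \<open>
  Gauss's lemma: pseudo-division gives \<open>a p = q s\<close> over the integers, as the remainder vanishes by
  minimality, and the constant \<open>a\<close> divides \<open>s\<close>, as \<open>q\<close> has content 1.  Consequently \<open>q\<close> has leading coefficient
  \<open>\<plusminus>1\<close>, which is how an algebraic integer is recognised from its minimal polynomial.
\<close>
lemma primitive_root_dvd_monic:
  fixes q p :: "int poly" and x :: "'a::field_char_0"
  assumes q: "ipoly q x = 0" "content q = 1" "degree q > 0"
    and p: "ipoly p x = 0" "lead_coeff p = 1"
    and minimal: "\<And>f. ipoly f x = 0 \<Longrightarrow> degree f < degree q \<Longrightarrow> f = 0"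
  shows "q dvd p"
proof -
  have q0: "q \<noteq> 0" using q(3) by auto
  obtain a s where as: "a \<noteq> 0" "smult a p = q * s + pseudo_mod p q"
    using pseudo_mod(1)[OF q0, of p] by auto
  have "of_int a * ipoly p x = ipoly q x * ipoly s x
      + ipoly (pseudo_mod p q) x"
    using arg_cong[OF as(2), of "\<lambda>f. ipoly f x"]
    by (simp add: ipoly_add ipoly_smult ipoly_mult)
  then have "ipoly (pseudo_mod p q) x = 0" using p q by simp
  moreover have "pseudo_mod p q = 0 \<or> degree (pseudo_mod p q) < degree q" using pseudo_mod(2)[OF q0] .
  ultimately have "pseudo_mod p q = 0" using minimal by blast
  then have eq: "smult a p = q * s" using as by simp
  have "[:a:] dvd q * s" unfolding eq[symmetric] by (intro dvdI[of _ _ p]) simp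
  then have "a dvd content (q * s)" by (simp add: const_poly_dvd_iff_dvd_content)
  then have "[:a:] dvd s" using q(2) by (simp add: content_mult const_poly_dvd_iff_dvd_content)
  then obtain u where "s = smult a u" by (auto elim!: dvdE)
  then have "smult a p = smult a (q * u)" using eq by simp
  then have "p = q * u" using as(1) by (simp add: smult_cancel)
  then show ?thesis by simp
qed

lemma dvd_of_square_dvd_squarefree_mult:
  fixes d :: nat and m k :: int
  assumes "squarefree d" "m \<noteq> 0" "m\<^sup>2 dvd int d * k\<^sup>2"
  shows "m dvd k"
proof -
  define g where "g = gcd m k"
  have g0: "g \<noteq> 0" using assms(2) by (simp add: g_def)
  obtain m' k' where mk: "m = m' * g" "k = k' * g" "coprime m' k'"
    using gcd_coprime_exists[of m k] g0 unfolding g_def by blast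
  have "g\<^sup>2 * m'\<^sup>2 dvd g\<^sup>2 * (int d * k'\<^sup>2)"
    using assms(3) by (simp add: mk power_mult_distrib mult.commute mult.left_commute)
  then have "m'\<^sup>2 dvd int d * k'\<^sup>2" using g0 by simp
  moreover have "coprime (m'\<^sup>2) (k'\<^sup>2)" using mk(3) by simp
  ultimately have "m'\<^sup>2 dvd int d" by (simp add: coprime_dvd_mult_left_iff)
  then have "int ((nat \<bar>m'\<bar>)\<^sup>2) dvd int d" by simp
  then have "(nat \<bar>m'\<bar>)\<^sup>2 dvd d" by (simp only: int_dvd_int_iff)
  then have "nat \<bar>m'\<bar> dvd 1" using assms(1) by (rule squarefreeD[rotated])
  then have "is_unit m'" by (simp add: nat_dvd_iff)
  then have "m' dvd k'" by (rule unit_imp_dvd)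
  then show ?thesis by (simp add: mk)
qed

text \<open>
  The ring \<open>\<int>[\<i> \<surd>d]\<close>.
\<close>
definition root_lattice :: "nat \<Rightarrow> complex set" where
  "root_lattice d = {of_int m + of_int n * (\<i> * of_real (sqrt (real d))) | m n. True}"

lemma imag_quad_field_common_denominator:
  assumes "x \<in> imag_quad_field d"
  obtains u v m :: int where "m > 0"
    "x = (of_int u + of_int v * (\<i> * of_real (sqrt (real d)))) / of_int m"
proof -
  obtain p q where pq: "p \<in> \<rat>" "q \<in> \<rat>" "x = p + q * (\<i> * of_real (sqrt (real d)))"
    using assms by (auto simp: imag_quad_field_def)
  obtain a b a' b' where *: "b > 0" "p = of_int a / of_int b" "b' > 0" "q = of_int a' / of_int b'"
    using pq(1,2) by (metis Rats_cases')
  have "x = (of_int (a * b') + of_int (a' * b) * (\<i> * of_real (sqrt (real d)))) / of_int (b * b')"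
    using * by (simp add: pq(3) field_simps)
  moreover have "b * b' > 0" using * by simp
  ultimately show thesis using that by blast
qed

text \<open>
  For \<open>x = (u + v \<omega>) / m\<close> with \<open>\<omega> = \<i> \<surd>d\<close> and \<open>v \<noteq> 0\<close>, trace and norm \<open>T = 2 u / m\<close> and \<open>n = (u\<^sup>2 + d v\<^sup>2) / m\<^sup>2\<close> are
  integers by Gauss's lemma.  Then \<open>d (2 v / m)\<^sup>2 = 4 n - T\<^sup>2\<close> is an integer too, and since \<open>d\<close> is square-free, so is
  \<open>2 v / m\<close>.
\<close>
lemma twice_imag_quad_integer:
  assumes d: "squarefree d" and x: "x \<in> ring_of_integers (imag_quad_field d)"
  shows "2 * x \<in> root_lattice d"
proof -
  define \<omega> where "\<omega> = \<i> * of_real (sqrt (real d))"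
  have d0: "d > 0" using d by (cases d) auto
  have \<omega>2: "\<omega>\<^sup>2 = - of_nat d" 
    by (simp add: \<omega>_def power_mult_distrib flip: of_real_power)
  have int: "algebraic_int x" and xK: "x \<in> imag_quad_field d" using x by (auto simp: ring_of_integers_def)
  obtain u v m where m: "m > 0" "x = (of_int u + of_int v * \<omega>) / of_int m"
    using imag_quad_field_common_denominator[OF xK] unfolding \<omega>_def by blast
  have memI: "of_int k + of_int l * \<omega> \<in> root_lattice d" for k l
    unfolding root_lattice_def \<omega>_def by blast
  show ?thesis
  proof (cases "v = 0")
    case True
    then have "x \<in> \<rat>" using m by simp
    then obtain k where "x = of_int k" using rational_algebraic_int_is_int[OF int] by (auto elim: Ints_cases)
    then show ?thesis using memI[of "2 * k" 0] by simp
  next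
    case False
    have Imx: "Im x = of_int v * sqrt (real d) / of_int m"
      by (simp add: m(2) \<omega>_def)
    then have Imx0: "Im x \<noteq> 0" using False d0 m(1) by simp
    \<comment> \<open>\<open>q\<close> is \<open>m\<^sup>2\<close> times the minimal polynomial of \<open>x\<close>, and \<open>q'\<close> its primitive part.\<close>
    define q where "q = [:u\<^sup>2 + int d * v\<^sup>2, - 2 * u * m, m\<^sup>2:]"
    define q' where "q' = primitive_part q"
    have q0: "q \<noteq> 0" using m by (simp add: q_def)
    have qq': "q = smult (content q) q'" by (simp add: q'_def)
    have deg: "degree q = 2" using m by (simp add: q_def)
    have mx: "of_int m * x = of_int u + of_int v * \<omega>" using m by simp
    have "ipoly q x = (of_int m * x - of_int u)\<^sup>2 + of_nat d * (of_int v)\<^sup>2"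
      by (simp add: q_def algebra_simps power2_eq_square)
    also have "\<dots> = 0" unfolding mx by (simp add: power_mult_distrib \<omega>2)
    finally have "ipoly q' x = 0" using q0 by (subst (asm) qq') (simp add: ipoly_smult)
    moreover have "content q' = 1" using q0 by (simp add: q'_def)
    moreover have deg': "degree q' = 2" using deg by (simp add: q'_def)
    moreover obtain p where p: "ipoly p x = 0" "lead_coeff p = 1"
      using int unfolding algebraic_int_altdef_ipoly ipoly_def by blast
    moreover have "f = 0" if f: "ipoly f x = 0" "degree f < degree q'" for f
    proof -
      have "f = [:coeff f 0, coeff f 1:]"
        using f(2) deg' by (intro poly_eqI) (auto simp: coeff_pCons coeff_eq_0 split: nat.splits)
      then obtain f0 f1 where f01: "f = [:f0, f1:]" by blast
      then have "Im (of_int f0 + x * of_int f1) = 0" using f(1) by simp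
      then have "f1 = 0" using Imx0 by simp
      then show ?thesis using f(1) f01 by simp
    qed
    ultimately have "q' dvd p" by (intro primitive_root_dvd_monic[of q' x p]) auto
    then have "lead_coeff q' dvd lead_coeff p" by (auto elim!: dvdE simp: lead_coeff_mult)
    then have unit: "is_unit (coeff q' 2)" using p(2) deg' by simp
    define T where "T = - (coeff q' 1 * coeff q' 2)"
    define n where "n = coeff q' 0 * coeff q' 2"
    have e2: "coeff q' 2 * coeff q' 2 = 1" using unit by (auto simp: zdvd1_eq abs_if split: if_splits)
    have coeffs: "content q * coeff q' 2 = m\<^sup>2" "content q * coeff q' 1 = - 2 * u * m" "content q * coeff q' 0 = u\<^sup>2 + int d * v\<^sup>2"
      using arg_cong[OF qq', of "\<lambda>f. coeff f 2"] arg_cong[OF qq', of "\<lambda>f. coeff f 1"] arg_cong[OF qq', of "\<lambda>f. coeff f 0"]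
      by (simp_all add: q_def numeral_2_eq_2)
    have c: "content q = m\<^sup>2 * coeff q' 2"
      using coeffs(1) e2 by (metis mult.assoc mult.right_neutral)
    have "m * (2 * u) = m * (m * T)" using coeffs(2) unfolding c T_def by (simp add: power2_eq_square algebra_simps)
    then have uT: "2 * u = m * T" using m by simp
    have "u\<^sup>2 + int d * v\<^sup>2 = m\<^sup>2 * n" using coeffs(3) unfolding c n_def by (simp add: algebra_simps)
    then have "int d * (2 * v)\<^sup>2 = 4 * m\<^sup>2 * n - (2 * u)\<^sup>2" by (simp add: power2_eq_square)
    also have "\<dots> = m\<^sup>2 * (4 * n - T\<^sup>2)" unfolding uT by (simp add: power2_eq_square algebra_simps)
    finally have "m\<^sup>2 dvd int d * (2 * v)\<^sup>2" by simp
    then have "m dvd 2 * v" using d m by (intro dvd_of_square_dvd_squarefree_mult[of d m]) auto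
    then obtain w where w: "2 * v = m * w" by blast
    have "2 * x = (of_int (2 * u) + of_int (2 * v) * \<omega>) / of_int m" by (simp add: m(2) add_divide_distrib)
    also have "\<dots> = of_int T + of_int w * \<omega>" unfolding uT w using m(1) by (simp add: field_simps)
    finally show ?thesis using memI by simp
  qed
qed

lemma discrete_order_imag_quad:
  assumes d: "squarefree d"
  shows "discrete_order (imag_quad_field d) (root_lattice d)"
proof -
  define \<omega> where "\<omega> = \<i> * of_real (sqrt (real d))"
  have d0: "d > 0" using d by (cases d) auto
  have \<omega>2: "\<omega> * \<omega> = - of_nat d"
    by (simp add: \<omega>_def mult.left_commute mult.assoc flip: of_real_mult) 
  have K: "imag_quad_field d = {p + q * \<omega> | p q. p \<in> \<rat> \<and> q \<in> \<rat>}"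
    unfolding imag_quad_field_def \<omega>_def ..
  have L: "root_lattice d = {of_int m + of_int n * \<omega> | m n. True}"
    unfolding root_lattice_def \<omega>_def ..
  have KI: "p + q * \<omega> \<in> imag_quad_field d" if "p \<in> \<rat>" "q \<in> \<rat>" for p q using that unfolding K by blast
  have LI: "of_int m + of_int n * \<omega> \<in> root_lattice d" for m n unfolding L by blast
  have KE: "\<exists>p q. x = p + q * \<omega> \<and> p \<in> \<rat> \<and> q \<in> \<rat>" if "x \<in> imag_quad_field d" for x
    using that unfolding K by (simp only: mem_Collect_eq)
  have LE: "\<exists>m n. x = of_int m + of_int n * \<omega>" if "x \<in> root_lattice d" for x
    using that unfolding L by (simp only: mem_Collect_eq simp_thms)
  show ?thesis
  proof
    show "1 \<in> imag_quad_field d" using KI[of 1 0] by simp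
    show "1 \<in> root_lattice d" using LI[of 1 0] by simp
    show "x - y \<in> imag_quad_field d" if xy: "x \<in> imag_quad_field d" "y \<in> imag_quad_field d" for x y
    proof -
      obtain p q where "p \<in> \<rat>" "q \<in> \<rat>" "x = p + q * \<omega>" using KE[OF xy(1)] by metis
      moreover obtain p' q' where "p' \<in> \<rat>" "q' \<in> \<rat>" "y = p' + q' * \<omega>" using KE[OF xy(2)] by metis
      ultimately show ?thesis using KI[of "p - p'" "q - q'"] by (simp add: algebra_simps)
    qed
    show "x - y \<in> root_lattice d" if xy: "x \<in> root_lattice d" "y \<in> root_lattice d" for x y
    proof -
      obtain p q where "x = of_int p + of_int q * \<omega>" using LE[OF xy(1)] by metis
      moreover obtain p' q' where "y = of_int p' + of_int q' * \<omega>" using LE[OF xy(2)] by metis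
      ultimately show ?thesis using LI[of "p - p'" "q - q'"] by (simp add: algebra_simps)
    qed
    show "x * y \<in> root_lattice d" if xy: "x \<in> root_lattice d" "y \<in> root_lattice d" for x y
    proof -
      obtain p q where x: "x = of_int p + of_int q * \<omega>" using LE[OF xy(1)] by metis
      obtain p' q' where y: "y = of_int p' + of_int q' * \<omega>" using LE[OF xy(2)] by metis
      have "x * y = of_int (p * p') + of_int (p * q' + q * p') * \<omega> + of_int (q * q') * (\<omega> * \<omega>)"
        unfolding x y by (simp add: algebra_simps)
      also have "\<dots> = of_int (p * p' - int d * (q * q')) + of_int (p * q' + q * p') * \<omega>"
        unfolding \<omega>2 by (simp add: algebra_simps)
      finally show ?thesis by (simp only: LI)
    qed
    show "x / y \<in> imag_quad_field d" if xy: "x \<in> imag_quad_field d" "y \<in> imag_quad_field d" for x y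
    proof (cases "y = 0")
      case True
      then show ?thesis using KI[of 0 0] by simp
    next
      case False
      obtain p q where pq: "p \<in> \<rat>" "q \<in> \<rat>" "x = p + q * \<omega>" using KE[OF xy(1)] by metis
      obtain p' q' where pq': "p' \<in> \<rat>" "q' \<in> \<rat>" "y = p' + q' * \<omega>" using KE[OF xy(2)] by metis
      note * = pq(1,2) pq'(1,2) pq(3) pq'(3)
      have cnj: "cnj y = p' - q' * \<omega>"
        using *(3,4) by (auto simp: *(6) \<omega>_def elim!: Rats_cases')
      define N where "N = p' * p' + of_nat d * (q' * q')"
      have N: "y * cnj y = N"
      proof -
        have "y * cnj y = p' * p' - q' * q' * (\<omega> * \<omega>)" unfolding cnj unfolding *(6) by (simp add: algebra_simps)
        then show ?thesis unfolding \<omega>2 N_def by (simp add: algebra_simps)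
      qed
      have NQ: "N \<in> \<rat>" using * by (auto simp: N_def)
      have N0: "N \<noteq> 0" using False unfolding N[symmetric] by simp
      have "x * cnj y = p * p' + (q * p' - p * q') * \<omega> - q * q' * (\<omega> * \<omega>)"
        unfolding cnj *(5) by (simp add: algebra_simps)
      then have "x * cnj y = p * p' + of_nat d * (q * q') + (q * p' - p * q') * \<omega>"
        unfolding \<omega>2 by (simp add: algebra_simps)
      moreover have "x / y = x * cnj y / N" using False N by (simp flip: N)
      ultimately have "x / y = (p * p' + of_nat d * (q * q')) / N + (q * p' - p * q') / N * \<omega>"
        by (simp add: add_divide_distrib)
      moreover have "(p * p' + of_nat d * (q * q')) / N \<in> \<rat>" "(q * p' - p * q') / N \<in> \<rat>"
        using *(1-4) NQ by (auto intro!: Rats_divide)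
      ultimately show ?thesis using KI by metis
    qed
    show "root_lattice d \<subseteq> imag_quad_field d" unfolding L using KI by auto
    show "1 \<le> norm x" if xy: "x \<in> root_lattice d" "x \<noteq> 0" for x
    proof -
      obtain k l where x: "x = of_int k + of_int l * \<omega>" using LE[OF xy(1)] by metis
      have "(norm x)\<^sup>2 = of_int (k\<^sup>2 + int d * l\<^sup>2)"
        by (simp add: x \<omega>_def cmod_power2 power_mult_distrib)
      moreover have "k\<^sup>2 + int d * l\<^sup>2 \<ge> 1"
      proof -
        have "k \<noteq> 0 \<or> l \<noteq> 0" using xy(2) x by auto
        then have "k\<^sup>2 + int d * l\<^sup>2 \<noteq> 0"
          using d0 by (auto simp: add_nonneg_eq_0_iff)
        moreover have "k\<^sup>2 + int d * l\<^sup>2 \<ge> 0" by simp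
        ultimately show ?thesis by linarith
      qed
      ultimately have "1 \<le> (norm x)\<^sup>2" by (metis of_int_1_le_iff)
      then show ?thesis by (simp add: power2_nonneg_ge_1_iff)
    qed
    show "2 * x \<in> root_lattice d" if xy: "x \<in> ring_of_integers (imag_quad_field d)" for x
      using twice_imag_quad_integer[OF d xy] .
    show "\<exists>n\<in>root_lattice d. n \<noteq> 0 \<and> n * x \<in> root_lattice d" if xy: "x \<in> imag_quad_field d" for x
    proof -
      obtain u v m where m: "m > 0" "x = (of_int u + of_int v * \<omega>) / of_int m"
        using imag_quad_field_common_denominator[OF xy] unfolding \<omega>_def by blast
      have "of_int m * x = of_int u + of_int v * \<omega>" using m by simp
      then have "of_int m * x \<in> root_lattice d" using LI by simp
      moreover have "of_int m \<in> root_lattice d" using LI[of m 0] by simp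
      ultimately show ?thesis using m(1) by (intro bexI[of _ "of_int m"]) auto
    qed
  qed
qed


section \<open>Badly approximable points\<close>

text \<open>
  The type class makes \<open>'a\<close> a stand-in for both completions, \<open>real\<close> and \<open>complex\<close>.
\<close>
locale approximation_family = discrete_order K L
  for K L :: "'a::{real_normed_field, euclidean_space} set" +
  fixes \<beta>0 :: 'a
  assumes \<beta>0: "\<beta>0 \<in> quad_irrationals K"
begin

abbreviation conj_gap :: "'a \<Rightarrow> real" where
  "conj_gap \<beta> \<equiv> norm (\<beta> - galois_conj K \<beta>)"

text \<open>
  The superlevel set of \<^const>\<open>approx_const\<close> at \<open>\<epsilon>\<close>, freed from the infimum.
\<close>
definition well_avoiding :: "real \<Rightarrow> 'a set" where
  "well_avoiding \<epsilon> = {x. \<forall>\<beta>\<in>psl_orbit K \<beta>0. \<epsilon> * conj_gap \<beta> \<le> dist x \<beta>}"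

lemma conj_gap_pos: "\<beta> \<in> psl_orbit K \<beta>0 \<Longrightarrow> conj_gap \<beta> > 0"
  using orbit_separated_family[OF \<beta>0] separated_family.r_pos by blast

lemma approx_const_bdd_below:
  "bdd_below ((\<lambda>\<beta>. inverse (conj_gap \<beta>) * norm (x - \<beta>)) ` psl_orbit K \<beta>0)"
  by (intro bdd_belowI[of _ 0]) auto

lemma approx_const_ge_iff: "\<epsilon> \<le> approx_const K \<beta>0 x \<longleftrightarrow> x \<in> well_avoiding \<epsilon>"
proof -
  have "\<epsilon> \<le> approx_const K \<beta>0 x \<longleftrightarrow> (\<forall>\<beta>\<in>psl_orbit K \<beta>0. \<epsilon> \<le> inverse (conj_gap \<beta>) * norm (x - \<beta>))"
    unfolding approx_const_def
    by (rule le_cINF_iff[OF _ approx_const_bdd_below]) (use base_in_orbit in auto)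
  also have "\<dots> \<longleftrightarrow> (\<forall>\<beta>\<in>psl_orbit K \<beta>0. \<epsilon> * conj_gap \<beta> \<le> dist x \<beta>)"
  proof (rule ball_cong[OF refl])
    fix \<beta> assume "\<beta> \<in> psl_orbit K \<beta>0"
    then show "\<epsilon> \<le> inverse (conj_gap \<beta>) * norm (x - \<beta>) \<longleftrightarrow> \<epsilon> * conj_gap \<beta> \<le> dist x \<beta>"
      using conj_gap_pos[of \<beta>] by (simp add: field_simps dist_norm)
  qed
  finally show ?thesis by (simp add: well_avoiding_def)
qed

lemma Bad_eq: "Bad K \<beta>0 = {x. \<exists>\<epsilon>>0. \<forall>\<beta>\<in>psl_orbit K \<beta>0. \<epsilon> * conj_gap \<beta> \<le> dist x \<beta>}"
proof (intro set_eqI iffI)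
  fix x assume "x \<in> Bad K \<beta>0"
  then have "approx_const K \<beta>0 x > 0" "x \<in> well_avoiding (approx_const K \<beta>0 x)"
    using approx_const_ge_iff by (auto simp: Bad_def)
  then show "x \<in> {x. \<exists>\<epsilon>>0. \<forall>\<beta>\<in>psl_orbit K \<beta>0. \<epsilon> * conj_gap \<beta> \<le> dist x \<beta>}"
    by (auto simp: well_avoiding_def)
next
  fix x assume "x \<in> {x. \<exists>\<epsilon>>0. \<forall>\<beta>\<in>psl_orbit K \<beta>0. \<epsilon> * conj_gap \<beta> \<le> dist x \<beta>}"
  then obtain \<epsilon> where "\<epsilon> > 0" "x \<in> well_avoiding \<epsilon>" by (auto simp: well_avoiding_def)
  then show "x \<in> Bad K \<beta>0" using approx_const_ge_iff[of \<epsilon> x] by (auto simp: Bad_def)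
qed

theorem Bad_absolute_winning: "absolute_winning 1 UNIV (Bad K \<beta>0)"
  unfolding absolute_winning_def Bad_eq
  using orbit_separated_family[OF \<beta>0] separated_family_absolute_winning by blast

lemma well_avoiding_subset_level:
  "well_avoiding (exp (- t)) \<subseteq> {x \<in> Bad K \<beta>0. - ln (approx_const K \<beta>0 x) \<le> t}"
proof
  fix x assume "x \<in> well_avoiding (exp (- t))"
  then have c: "exp (- t) \<le> approx_const K \<beta>0 x" by (simp add: approx_const_ge_iff)
  have pos: "approx_const K \<beta>0 x > 0" by (rule less_le_trans[OF _ c]) simp
  with c have "- t \<le> ln (approx_const K \<beta>0 x)" by (simp add: ln_ge_iff)
  with pos show "x \<in> {x \<in> Bad K \<beta>0. - ln (approx_const K \<beta>0 x) \<le> t}" by (simp add: Bad_def)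
qed

lemma touching_point_in_level:
  assumes x: "x \<in> well_avoiding (exp (- t))" and \<beta>: "\<beta> \<in> psl_orbit K \<beta>0" "dist x \<beta> = exp (- t) * conj_gap \<beta>"
  shows "x \<in> Bad K \<beta>0" "- ln (approx_const K \<beta>0 x) = t"
proof -
  have "approx_const K \<beta>0 x \<le> inverse (conj_gap \<beta>) * norm (x - \<beta>)"
    unfolding approx_const_def by (rule cINF_lower[OF approx_const_bdd_below \<beta>(1)])
  also have "\<dots> = exp (- t)" using \<beta>(2) conj_gap_pos[OF \<beta>(1)] by (simp add: dist_norm)
  finally have "approx_const K \<beta>0 x = exp (- t)" using x approx_const_ge_iff[of "exp (- t)" x] by simp
  then show "x \<in> Bad K \<beta>0" "- ln (approx_const K \<beta>0 x) = t" by (simp_all add: Bad_def)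
qed

text \<open>
  The cube has side \<open>max B 1\<close>, so that no point of the orbit is too large for the first stage.
\<close>
theorem bad_dim_le_lower_bound:
  "\<exists>t1 k0. t1 > 0 \<and> k0 > 0 \<and> (\<forall>t\<ge>t1. ereal (real DIM('a) - k0 / (t * exp (real DIM('a) * t / 2))) \<le> bad_dim_le K \<beta>0 t)"
proof -
  let ?n = "DIM('a)"
  obtain \<kappa> B where \<kappa>: "\<kappa> \<le> 1" and fam: "separated_family (psl_orbit K \<beta>0) conj_gap \<kappa> B"
    using orbit_separated_family[OF \<beta>0] by blast
  interpret F: separated_family "psl_orbit K \<beta>0" conj_gap \<kappa> B by (rule fam)
  have "real (?n + 2) / \<kappa> > 0" using F.\<kappa>_pos by simp
  then obtain t1 k0 :: real where t1: "t1 > 0" and k0: "k0 > 0"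
    and *: "\<And>t. t \<ge> t1 \<Longrightarrow> \<exists>R::nat. R \<ge> 2 \<and> overlap_bound 1 ?n + 2 \<le> R ^ ?n \<and>
       real (?n + 2) / \<kappa> * (real R)\<^sup>2 \<le> exp t \<and>
       real ?n - k0 / (t * exp (real ?n * t / 2)) \<le> ln (real (R ^ ?n - overlap_bound 1 ?n)) / ln (real R)"
    using dimension_asymptotics[of ?n "real (?n + 2) / \<kappa>" "overlap_bound 1 ?n"] DIM_positive[where 'a='a]
    by (metis One_nat_def Suc_leI)
  have "ereal (real ?n - k0 / (t * exp (real ?n * t / 2))) \<le> bad_dim_le K \<beta>0 t" if t: "t \<ge> t1" for t
  proof -
    obtain R :: nat where R: "R \<ge> 2" "overlap_bound 1 ?n + 2 \<le> R ^ ?n"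
        "real (?n + 2) / \<kappa> * (real R)\<^sup>2 \<le> exp t"
        "real ?n - k0 / (t * exp (real ?n * t / 2)) \<le> ln (real (R ^ ?n - overlap_bound 1 ?n)) / ln (real R)"
      using *[OF t] by blast
    define \<rho> where "\<rho> = max B 1"
    have \<rho>: "\<rho> > 0" by (simp add: \<rho>_def)
    have "ereal (real ?n - k0 / (t * exp (real ?n * t / 2)))
        \<le> ereal (ln (real (R ^ ?n - overlap_bound 1 ?n)) / ln (real R))" using R(4) by simp
    also have "\<dots> \<le> hausdorff_dim {x \<in> (\<lambda>s. \<rho> *\<^sub>R s) ` cbox (0::'a) One.
        \<forall>p\<in>psl_orbit K \<beta>0. exp (- t) * conj_gap p \<le> dist x p}"
    proof (rule separated_family_dimension[OF fam R(1) \<rho>, where \<mu> = 1])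
      show "exp (- t) * real (?n + 2) * (real R)\<^sup>2 \<le> \<kappa>"
        using R(3) F.\<kappa>_pos by (simp add: exp_minus field_simps)
      show "\<kappa> * conj_gap p \<le> real (?n + 2) * \<rho> * real R" if "p \<in> psl_orbit K \<beta>0" for p
      proof -
        have "\<kappa> * conj_gap p \<le> 1 * \<rho>"
          using F.r_le[OF that] \<kappa> F.\<kappa>_pos by (intro mult_mono) (auto simp: \<rho>_def)
        also have "\<dots> \<le> (real (?n + 2) * real R) * \<rho>"
          using R(1) \<rho> mult_mono[of 1 "real (?n + 2)" 1 "real R"] by (intro mult_right_mono) auto
        finally show ?thesis by (simp add: mult_ac)
      qed
    qed (use R(2) \<rho> in \<open>auto simp: dist_norm simp flip: scaleR_diff_right\<close>)
    also have "\<dots> \<le> bad_dim_le K \<beta>0 t"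
      unfolding bad_dim_le_def
      using well_avoiding_subset_level[of t] by (intro hausdorff_dim_mono) (auto simp: well_avoiding_def)
    finally show ?thesis .
  qed
  with t1 k0 show ?thesis by blast
qed

end

section \<open>Points on a circle around an orbit point\<close>
lemma dist_cis_bounds:
  assumes "\<bar>s - t\<bar> \<le> 1"
  shows "dist (cis s) (cis t) \<le> \<bar>s - t\<bar>" "\<bar>s - t\<bar> / 2 \<le> dist (cis s) (cis t)"
proof -
  have "cis s - cis t = cis t * (cis (s - t) - 1)" by (simp add: cis_mult right_diff_distrib)
  then have eq: "dist (cis s) (cis t) = 2 * \<bar>sin ((s - t) / 2)\<bar>"
    using dist_exp_i_1[of "s - t"] by (simp add: dist_norm norm_mult cis_conv_exp)
  show "dist (cis s) (cis t) \<le> \<bar>s - t\<bar>"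
    using abs_sin_x_le_abs_x[of "(s - t) / 2"] unfolding eq by simp
  have *: "x / 2 \<le> sin x" if x: "0 < x" "x \<le> 1" for x :: real
  proof -
    obtain z where z: "0 < z" "z < x" "sin x - sin 0 = (x - 0) * cos z"
      using MVT2[OF x(1), of sin cos] by (auto intro: DERIV_sin)
    have "1 \<le> pi / 3" using pi_gt3 by simp
    then have "cos (pi / 3) \<le> cos z" using z x by (intro cos_monotone_0_pi_le) auto
    then have "x * (1 / 2) \<le> x * cos z" using x by (intro mult_left_mono) (auto simp: cos_60)
    then show ?thesis using z(3) by simp
  qed
  have "\<bar>x\<bar> / 2 \<le> \<bar>sin x\<bar>" if "\<bar>x\<bar> \<le> 1" for x :: real
    using *[of x] *[of "- x"] that by (cases "x = 0"; cases "x > 0") auto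
  from this[of "(s - t) / 2"] show "\<bar>s - t\<bar> / 2 \<le> dist (cis s) (cis t)" using assms unfolding eq by simp
qed

text \<open>
  On the circle around \<open>\<beta>\<^sub>0\<close> of radius \<open>\<rho> = \<epsilon> r(\<beta>\<^sub>0)\<close>, with \<open>\<epsilon> = e\<^bsup>-t\<^esup>\<close>, consider another \<open>p\<close> in the orbit that is closer
  than \<open>\<epsilon> r(p)\<close> to some point of the circle.  Separation of \<open>p\<close> from \<open>\<beta>\<^sub>0\<close> gives
  \<open>\<kappa> min (r(\<beta>\<^sub>0)) (r(p)) < \<epsilon> (r(\<beta>\<^sub>0) + r(p))\<close>.  When \<open>t\<close> is so large that \<open>2 \<epsilon> B < \<kappa> r(\<beta>\<^sub>0)\<close>, this excludes
  \<open>r(p) \<ge> r(\<beta>\<^sub>0)\<close>, and so \<open>\<kappa> r(p) < 2 \<rho>\<close>.  The Cantor construction on the arc of angles in \<open>[0, 1]\<close> then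
  gives the dimension estimate, even with the defect \<open>k0 / (t e\<^bsup>t/2\<^esup>)\<close>.  The level sets are
  nonempty for \<open>t > k0\<close> because their dimension is positive.
\<close>
theorem bad_dim_eq_lower_bound:
  fixes K L :: "complex set"
  assumes "approximation_family K L \<beta>0"
  shows "\<exists>t0 k0. t0 > 0 \<and> k0 > 0 \<and> {t0..} \<subseteq> spectrum_set K \<beta>0 \<and>
    (\<forall>t\<ge>t0. ereal (1 - k0 / t) \<le> bad_dim_eq K \<beta>0 t)"
proof -
  interpret approximation_family K L \<beta>0 by fact
  obtain \<kappa> B where \<kappa>: "\<kappa> \<le> 1" and fam: "separated_family (psl_orbit K \<beta>0) conj_gap \<kappa> B"
    using orbit_separated_family[OF \<beta>0] by blast
  interpret F: separated_family "psl_orbit K \<beta>0" conj_gap \<kappa> B by (rule fam)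
  define P where "P = psl_orbit K \<beta>0 - {\<beta>0}"
  have famP: "separated_family P conj_gap \<kappa> B"
    using separated_family_subset[OF fam] by (auto simp: P_def)
  define r0 where "r0 = conj_gap \<beta>0"
  have r0: "r0 > 0" "r0 \<le> B" using F.r_pos[OF base_in_orbit] F.r_le[OF base_in_orbit] by (auto simp: r0_def)
  let ?C = "overlap_bound (1 / 2) 1"
  have "3 / \<kappa> > 0" using F.\<kappa>_pos by simp
  then obtain t1 k0 :: real where t1: "t1 > 0" and k0: "k0 > 0"
    and *: "\<And>t. t \<ge> t1 \<Longrightarrow> \<exists>R::nat. R \<ge> 2 \<and> ?C + 2 \<le> R ^ 1 \<and> 3 / \<kappa> * (real R)\<^sup>2 \<le> exp t \<and>
       real 1 - k0 / (t * exp (real 1 * t / 2)) \<le> ln (real (R ^ 1 - ?C)) / ln (real R)"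
    using dimension_asymptotics[of 1 "3 / \<kappa>" ?C] by (metis order_refl)
  define t0 where "t0 = max t1 (max (k0 + 1) (ln (2 * B / (\<kappa> * r0)) + 1))"
  have level: "ereal (1 - k0 / t) \<le> bad_dim_eq K \<beta>0 t" if t: "t \<ge> t0" for t
  proof -
    define \<epsilon> where "\<epsilon> = exp (- t)"
    define \<rho> where "\<rho> = \<epsilon> * r0"
    have \<epsilon>: "\<epsilon> > 0" and \<rho>: "\<rho> > 0" using r0 by (auto simp: \<epsilon>_def \<rho>_def)
    have tpos: "t > 0" and tt1: "t \<ge> t1" using t t1 by (auto simp: t0_def)
    have \<epsilon>B: "2 * \<epsilon> * B < \<kappa> * r0"
    proof -
      have "ln (2 * B / (\<kappa> * r0)) < t" using t by (auto simp: t0_def)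
      moreover have pos: "0 < 2 * B / (\<kappa> * r0)" using r0 F.\<kappa>_pos by simp
      ultimately have "2 * B / (\<kappa> * r0) < exp t" by (metis exp_less_cancel_iff exp_ln)
      then show ?thesis using r0 F.\<kappa>_pos by (simp add: \<epsilon>_def exp_minus field_simps)
    qed
    obtain R :: nat where R: "R \<ge> 2" "?C + 2 \<le> R ^ 1" "3 / \<kappa> * (real R)\<^sup>2 \<le> exp t"
        "real 1 - k0 / (t * exp (real 1 * t / 2)) \<le> ln (real (R ^ 1 - ?C)) / ln (real R)"
      using *[OF tt1] by blast
    define \<phi> where "\<phi> s = \<beta>0 + of_real \<rho> * cis s" for s
    have dist_\<phi>: "dist (\<phi> s) (\<phi> u) = \<rho> * dist (cis s) (cis u)" for s u
      using \<rho> by (simp add: \<phi>_def dist_norm norm_mult flip: right_diff_distrib)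
    have dist_\<beta>0: "dist (\<phi> s) \<beta>0 = \<rho>" for s
      using \<rho> by (simp add: \<phi>_def dist_norm norm_mult)
    have close: "\<bar>s - u\<bar> \<le> 1" if "s \<in> cbox (0::real) One" "u \<in> cbox (0::real) One" for s u
      using that by (auto simp: abs_le_iff)
    have "k0 / (t * exp (t / 2)) \<le> k0 / t"
      using k0 tpos mult_left_mono[of 1 "exp (t / 2)" t] by (intro divide_left_mono) auto
    then have "ereal (1 - k0 / t) \<le> ereal (ln (real (R ^ 1 - ?C)) / ln (real R))"
      using R(4) by simp
    also have "\<dots> \<le> hausdorff_dim {x \<in> \<phi> ` cbox (0::real) One. \<forall>p\<in>P. \<epsilon> * conj_gap p \<le> dist x p}"
    proof (rule separated_family_dimension[OF famP R(1) \<rho> _ \<epsilon>, where \<mu> = "1 / 2" and 'b = real, unfolded DIM_real])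
      show "1 / 2 * \<rho> * norm (s - u) \<le> dist (\<phi> s) (\<phi> u)" if "s \<in> cbox 0 One" "u \<in> cbox 0 One" for s u
        using dist_cis_bounds(2)[OF close[OF that]] \<rho> unfolding dist_\<phi> by (simp add: field_simps)
      show "dist (\<phi> s) (\<phi> u) \<le> \<rho> * norm (s - u)" if "s \<in> cbox 0 One" "u \<in> cbox 0 One" for s u
        using dist_cis_bounds(1)[OF close[OF that]] \<rho> unfolding dist_\<phi> by simp
      show "\<epsilon> * real (1 + 2) * (real R)\<^sup>2 \<le> \<kappa>"
        using R(3) F.\<kappa>_pos by (simp add: \<epsilon>_def exp_minus field_simps)
      show "\<kappa> * conj_gap p \<le> real (1 + 2) * \<rho> * real R"
        if p: "p \<in> P" and s: "dist (\<phi> s) p < \<epsilon> * conj_gap p" for p s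
      proof -
        have p': "p \<in> psl_orbit K \<beta>0" "\<beta>0 \<noteq> p" using p by (auto simp: P_def)
        have "\<kappa> * min r0 (conj_gap p) \<le> dist \<beta>0 p"
          unfolding r0_def using F.separated[OF base_in_orbit p'] .
        also have "\<dots> \<le> dist (\<phi> s) \<beta>0 + dist (\<phi> s) p" by (rule dist_triangle3)
        also have "\<dots> < \<epsilon> * r0 + \<epsilon> * conj_gap p" using s by (simp add: dist_\<beta>0 \<rho>_def)
        finally have sep: "\<kappa> * min r0 (conj_gap p) < \<epsilon> * r0 + \<epsilon> * conj_gap p" .
        have small: "conj_gap p < r0"
        proof (rule ccontr)
          assume "\<not> conj_gap p < r0"
          then have "\<kappa> * r0 < \<epsilon> * r0 + \<epsilon> * conj_gap p" using sep by (simp add: min_def)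
          also have "\<dots> \<le> \<epsilon> * B + \<epsilon> * B" using r0 F.r_le[OF p'(1)] \<epsilon> by (intro add_mono mult_left_mono) auto
          finally show False using \<epsilon>B by (simp add: mult.commute mult.left_commute)
        qed
        then have "\<kappa> * conj_gap p < \<epsilon> * r0 + \<epsilon> * conj_gap p" using sep by (simp add: min_def)
        also have "\<dots> \<le> \<epsilon> * r0 + \<epsilon> * r0" using small \<epsilon> by (intro add_mono mult_left_mono) auto
        also have "\<dots> \<le> 3 * \<rho> * 1" using \<rho> by (simp add: \<rho>_def)
        also have "\<dots> \<le> 3 * \<rho> * real R" using \<rho> R(1) by (intro mult_left_mono) auto
        finally show ?thesis by simp
      qed
    qed (use R(2) in auto)
    also have "\<dots> \<le> bad_dim_eq K \<beta>0 t"
      unfolding bad_dim_eq_def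
    proof (intro hausdorff_dim_mono subsetI)
      fix x assume x: "x \<in> {x \<in> \<phi> ` cbox (0::real) One. \<forall>p\<in>P. \<epsilon> * conj_gap p \<le> dist x p}"
      then have touch: "dist x \<beta>0 = exp (- t) * conj_gap \<beta>0"
        using dist_\<beta>0 by (auto simp: \<rho>_def \<epsilon>_def r0_def)
      then have "x \<in> well_avoiding (exp (- t))"
        using x by (auto simp: well_avoiding_def P_def \<epsilon>_def)
      then show "x \<in> {x \<in> Bad K \<beta>0. - ln (approx_const K \<beta>0 x) = t}"
        using touching_point_in_level[OF _ base_in_orbit touch] by blast
    qed
    finally show ?thesis .
  qed
  have "t \<in> spectrum_set K \<beta>0" if t: "t \<ge> t0" for t
  proof (rule ccontr)
    assume "t \<notin> spectrum_set K \<beta>0"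
    then have empty: "{x \<in> Bad K \<beta>0. - ln (approx_const K \<beta>0 x) = t} = {}"
      by (auto simp: spectrum_set_def)
    have "k0 < t" using t by (auto simp: t0_def)
    then have pos: "1 - k0 / t > 0" using k0 by simp
    have "ereal (1 - k0 / t) \<le> hausdorff_dim ({} :: complex set)"
      using level[OF t] unfolding bad_dim_eq_def empty .
    also have "\<dots> \<le> ereal ((1 - k0 / t) / 2)" by (rule hausdorff_dim_empty_le) (use pos in simp)
    finally have "1 - k0 / t \<le> (1 - k0 / t) / 2" by simp
    then show False using pos by simp
  qed
  moreover have "t0 > 0" using t1 by (simp add: t0_def)
  ultimately show ?thesis using level k0 by blast
qed

theorem theorem1p12:
  shows
    "(\<exists>\<beta>s>0. \<forall>\<beta>0 \<in> quad_irrationals (\<rat> :: real set).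
        absolute_winning \<beta>s UNIV (Bad \<rat> \<beta>0))
     \<and>
     (\<exists>\<beta>s>0. \<forall>d::nat. squarefree d \<longrightarrow>
        (\<forall>\<beta>0 \<in> quad_irrationals (imag_quad_field d).
           absolute_winning \<beta>s UNIV (Bad (imag_quad_field d) \<beta>0)))
     \<and>
     (\<forall>\<beta>0 \<in> quad_irrationals (\<rat> :: real set). \<exists>t1 k0. k0 > 0 \<and>
        (\<forall>t \<in> spectrum_set \<rat> \<beta>0. t \<ge> t1 \<longrightarrow>
           bad_dim_le \<rat> \<beta>0 t \<ge>
             ereal (real DIM(real) - k0 / (t * exp (real DIM(real) * t / 2)))))
     \<and>
     (\<forall>d::nat. squarefree d \<longrightarrow>
        (\<forall>\<beta>0 \<in> quad_irrationals (imag_quad_field d). \<exists>t0 t1 k0. k0 > 0 \<and>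
           {t0..} \<subseteq> spectrum_set (imag_quad_field d) \<beta>0 \<and>
           (\<forall>t\<ge>t0. bad_dim_eq (imag_quad_field d) \<beta>0 t \<ge> ereal (1 - k0 / t)) \<and>
           (\<forall>t \<in> spectrum_set (imag_quad_field d) \<beta>0. t \<ge> t1 \<longrightarrow>
              bad_dim_le (imag_quad_field d) \<beta>0 t \<ge>
                ereal (real DIM(complex) - k0 / (t * exp (real DIM(complex) * t / 2))))))"
proof -
  have real: "approximation_family \<rat> \<int> \<beta>0" if "\<beta>0 \<in> quad_irrationals (\<rat> :: real set)" for \<beta>0
    using that discrete_order_Rats by (simp add: approximation_family_def approximation_family_axioms_def)
  have complex: "approximation_family (imag_quad_field d) (root_lattice d) \<beta>0"
    if "squarefree d" "\<beta>0 \<in> quad_irrationals (imag_quad_field d)" for d \<beta>0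
    using that discrete_order_imag_quad by (simp add: approximation_family_def approximation_family_axioms_def)
  show ?thesis
  proof (intro conjI)
    show "\<exists>\<beta>s>0. \<forall>\<beta>0 \<in> quad_irrationals (\<rat> :: real set). absolute_winning \<beta>s UNIV (Bad \<rat> \<beta>0)"
      using approximation_family.Bad_absolute_winning[OF real] by (intro exI[of _ 1]) auto
    show "\<exists>\<beta>s>0. \<forall>d::nat. squarefree d \<longrightarrow> (\<forall>\<beta>0 \<in> quad_irrationals (imag_quad_field d).
        absolute_winning \<beta>s UNIV (Bad (imag_quad_field d) \<beta>0))"
      using approximation_family.Bad_absolute_winning[OF complex] by (intro exI[of _ 1]) auto
    show "\<forall>\<beta>0 \<in> quad_irrationals (\<rat> :: real set). \<exists>t1 k0. k0 > 0 \<and>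
        (\<forall>t \<in> spectrum_set \<rat> \<beta>0. t \<ge> t1 \<longrightarrow>
           bad_dim_le \<rat> \<beta>0 t \<ge> ereal (real DIM(real) - k0 / (t * exp (real DIM(real) * t / 2))))"
      using approximation_family.bad_dim_le_lower_bound[OF real] by blast
    show "\<forall>d::nat. squarefree d \<longrightarrow>
        (\<forall>\<beta>0 \<in> quad_irrationals (imag_quad_field d). \<exists>t0 t1 k0. k0 > 0 \<and>
           {t0..} \<subseteq> spectrum_set (imag_quad_field d) \<beta>0 \<and>
           (\<forall>t\<ge>t0. bad_dim_eq (imag_quad_field d) \<beta>0 t \<ge> ereal (1 - k0 / t)) \<and>
           (\<forall>t \<in> spectrum_set (imag_quad_field d) \<beta>0. t \<ge> t1 \<longrightarrow>
              bad_dim_le (imag_quad_field d) \<beta>0 t \<ge>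
                ereal (real DIM(complex) - k0 / (t * exp (real DIM(complex) * t / 2)))))"
    proof (intro allI impI ballI)
      fix d \<beta>0 assume d: "squarefree d" and \<beta>0: "\<beta>0 \<in> quad_irrationals (imag_quad_field d)"
      let ?K = "imag_quad_field d"
      obtain t1 k1 where 1: "t1 > 0" "k1 > 0"
        "\<And>t. t \<ge> t1 \<Longrightarrow> ereal (real DIM(complex) - k1 / (t * exp (real DIM(complex) * t / 2))) \<le> bad_dim_le ?K \<beta>0 t"
        using approximation_family.bad_dim_le_lower_bound[OF complex[OF d \<beta>0]] by blast
      obtain t0 k0 where 0: "t0 > 0" "k0 > 0" "{t0..} \<subseteq> spectrum_set ?K \<beta>0"
        "\<And>t. t \<ge> t0 \<Longrightarrow> ereal (1 - k0 / t) \<le> bad_dim_eq ?K \<beta>0 t"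
        using bad_dim_eq_lower_bound[OF complex[OF d \<beta>0]] by blast
      have weaken: "ereal (a - max k0 k1 / y) \<le> ereal (a - k / y)" if "y > 0" "k \<le> max k0 k1" for a k y
        using that by (simp add: divide_right_mono)
      show "\<exists>t0 t1 k0. k0 > 0 \<and> {t0..} \<subseteq> spectrum_set ?K \<beta>0 \<and>
           (\<forall>t\<ge>t0. bad_dim_eq ?K \<beta>0 t \<ge> ereal (1 - k0 / t)) \<and>
           (\<forall>t \<in> spectrum_set ?K \<beta>0. t \<ge> t1 \<longrightarrow>
              bad_dim_le ?K \<beta>0 t \<ge> ereal (real DIM(complex) - k0 / (t * exp (real DIM(complex) * t / 2))))"
      proof (rule exI[of _ t0], rule exI[of _ t1], rule exI[of _ "max k0 k1"], intro conjI allI impI ballI)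
        show "ereal (1 - max k0 k1 / t) \<le> bad_dim_eq ?K \<beta>0 t" if "t \<ge> t0" for t
          using that 0(1) by (intro order_trans[OF weaken 0(4)]) auto
        show "ereal (real DIM(complex) - max k0 k1 / (t * exp (real DIM(complex) * t / 2))) \<le> bad_dim_le ?K \<beta>0 t"
          if "t \<ge> t1" for t
          using that 1(1) by (intro order_trans[OF weaken 1(3)]) auto
      qed (use 0 in auto)
    qed
  qed
qed

end
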